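(* Let $y\colon\mathbb{R}\to\mathbb{R}$ be bounded and uniformly continuous, let $c>4$ be fixed, let $g(x):=-x-2c\,\dfrac{x}{1+x^2}$, and for $\lambda\in\mathbb{R}$ consider $$(E_\lambda)\qquad x'=\lambda+y(t)+g(x).$$ Let $x_1(c):=\sqrt{c-1-\sqrt{c(c-4)}}$, $x_2(c):=\sqrt{c-1+\sqrt{c(c-4)}}$, $\lambda_1(c):=-g(x_2(c))$, $\lambda_2(c):=-g(x_1(c))$ and $h_1(c):=\lambda_2(c)-\lambda_1(c)$. (1) If $\lambda>\lambda_1(c)-\inf_{r\in\mathbb{R}}y(r)$, then there exists exactly one positive bounded solution $u_\lambda$ of $(E_\lambda)$ strictly above $x_2(c)$; it is hyperbolic attractive, and $\lim_{t\to\infty}(u_\lambda(t)-x_\lambda(t))=0$ for any solution $x_\lambda$ of $(E_\lambda)$ taking at some time a value in $[x_2(c),\infty)$. (2) If $\lambda\in\big[-\inf_{r\in\mathbb{R}}y(r),\ \lambda_2(c)-\sup_{r\in\mathbb{R}}y(r)\big)$, then there exists exactly one positive bounded solution $l_\lambda$ of $(E_\lambda)$ strictly below $x_1(c)$; it is hyperbolic attractive, it is strictly positive if $\lambda>-\inf_{r\in\mathbb{R}}y(r)$, and $\lim_{t\to\infty}(l_\lambda(t)-x_\lambda(t))=0$ for any solution $x_\lambda$ of $(E_\lambda)$ taking at some time a value in $[0,x_1(c)]$. (3) If $\sup_{r\in\mathbb{R}}y(r)-\inf_{r\in\mathbb{R}}y(r)<h_1(c)$ and $$\lambda\in\mathcal{I}_1(c):=\Big(\lambda_1(c)-\inf_{r\in\mathbb{R}}y(r),\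 \lambda_2(c)-\sup_{r\in\mathbb{R}}y(r)\Big),$$ then $(E_\lambda)$ exhibits bistability. More precisely, the basins of attraction on the positive half-plane of the two attractive hyperbolic solutions $u_\lambda$ and $l_\lambda$ are separated by the graph of a repulsive hyperbolic solution $m_\lambda$ which is above $x_1(c)$ and below $x_2(c)$. (4) The conclusions of (3) (bistability, and separation of the basins of attraction on the positive half-plane of the two attractive hyperbolic solutions by the graph of a repulsive hyperbolic solution which is above $x_1(c)$ and below $x_2(c)$) also hold if $\sup_{r\in\mathbb{R}}y(r)-\inf_{r\in\mathbb{R}}y(r)\le h_1(c)$, $\lambda\in\big[\lambda_1(c)-\inf_{r\in\mathbb{R}}y(r),\ \lambda_2(c)-\sup_{r\in\mathbb{R}}y(r)\big]$, and neither of the constant maps $t\mapsto\inf_{r\in\mathbb{R}}y(r)$ and $t\mapsto\sup_{r\in\mathbb{R}}y(r)$ belongs to the hull $\Omega_y$ of $y$.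
   Context: A bounded solution is a solution defined on all of $\mathbb{R}$ and bounded. Two bounded solutions $b_1,b_2$ are uniformly separated if $\inf_{t\in\mathbb{R}}|b_1(t)-b_2(t)|>0$. A bounded solution $b$ of $(E_\lambda)$ is hyperbolic attractive (resp. hyperbolic repulsive) if there exist $k\ge1$ and $\gamma>0$ such that $\exp\left(\int_s^t g'(b(r))\,dr\right)\le k\,e^{-\gamma(t-s)}$ whenever $t\ge s$ (resp. $\exp\left(\int_s^t g'(b(r))\,dr\right)\le k\,e^{\gamma(t-s)}$ whenever $t\le s$). $(E_\lambda)$ exhibits bistability if there exist exactly two attractive hyperbolic solutions and they are uniformly separated and positive. "Positive" means $\ge0$ and "strictly positive" means $>0$; the positive half-plane is $\{(t,x): x\ge0\}$, which is positively invariant for $(E_\lambda)$ when $\lambda\ge-\inf_{r\in\mathbb{R}} y(r)$. For hyperbolic solutions $l_\lambda<m_\lambda<u_\lambda$, saying that the basins of attraction on the positive half-plane of $u_\lambda$ and $l_\lambda$ are separated by the graph of $m_\lambda$ means: any solution $x$ with $x(s)>m_\lambda(s)$ for some $s$ satisfies $\lim_{t\to\infty}(u_\lambda(t)-x(t))=0$, and any solution $x$ with $0\le x(s)<m_\lambda(s)$ for some $s$ satisfies $\lim_{t\to\infty}(l_\lambda(t)-x(t))=0$. The hull $\Omega_y$ is the closure of $\{y(\cdot+s): s\in\mathbb{R}\}$ in the compact-open topology of $C(\mathbb{R},\mathbb{R})$. *)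

theory Defs
  imports "HOL-Analysis.Analysis"
begin

definition g :: "real \<Rightarrow> real \<Rightarrow> real" where
  "g c x = - x - 2 * c * (x / (1 + x\<^sup>2))"

definition x1 :: "real \<Rightarrow> real" where
  "x1 c = sqrt (c - 1 - sqrt (c * (c - 4)))"

definition x2 :: "real \<Rightarrow> real" where
  "x2 c = sqrt (c - 1 + sqrt (c * (c - 4)))"

definition lambda1 :: "real \<Rightarrow> real" where
  "lambda1 c = - g c (x2 c)"

definition lambda2 :: "real \<Rightarrow> real" where
  "lambda2 c = - g c (x1 c)"

definition h1 :: "real \<Rightarrow> real" where
  "h1 c = lambda2 c - lambda1 c"

text \<open>Throughout, \<open>x\<close> is a total function of which only the values on the open interval
  \<open>I\<close> matter; the equation is \<open>x' = lam + y(t) + g c x\<close>.\<close>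

definition solution_on ::
  "real \<Rightarrow> (real \<Rightarrow> real) \<Rightarrow> real \<Rightarrow> real set \<Rightarrow> (real \<Rightarrow> real) \<Rightarrow> bool" where
  "solution_on c y lam I x \<longleftrightarrow>
     open I \<and> is_interval I \<and>
     (\<forall>t\<in>I. (x has_real_derivative (lam + y t + g c (x t))) (at t))"

definition maximal_solution ::
  "real \<Rightarrow> (real \<Rightarrow> real) \<Rightarrow> real \<Rightarrow> real set \<Rightarrow> (real \<Rightarrow> real) \<Rightarrow> bool" where
  "maximal_solution c y lam I x \<longleftrightarrow>
     solution_on c y lam I x \<and>
     (\<forall>J z. solution_on c y lam J z \<and> I \<subseteq> J \<and> (\<forall>t\<in>I. z t = x t) \<longrightarrow> J = I)"

definition bounded_solution ::
  "real \<Rightarrow> (real \<Rightarrow> real) \<Rightarrow> real \<Rightarrow> (real \<Rightarrow> real) \<Rightarrow> bool" where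
  "bounded_solution c y lam b \<longleftrightarrow> solution_on c y lam UNIV b \<and> bounded (range b)"

definition positive :: "(real \<Rightarrow> real) \<Rightarrow> bool" where
  "positive b \<longleftrightarrow> (\<forall>t. b t \<ge> 0)"

definition strictly_positive :: "(real \<Rightarrow> real) \<Rightarrow> bool" where
  "strictly_positive b \<longleftrightarrow> (\<forall>t. b t > 0)"

definition uniformly_separated :: "(real \<Rightarrow> real) \<Rightarrow> (real \<Rightarrow> real) \<Rightarrow> bool" where
  "uniformly_separated b1 b2 \<longleftrightarrow> (INF t. \<bar>b1 t - b2 t\<bar>) > 0"

definition hyperbolic_attractive ::
  "real \<Rightarrow> (real \<Rightarrow> real) \<Rightarrow> real \<Rightarrow> (real \<Rightarrow> real) \<Rightarrow> bool" where
  "hyperbolic_attractive c y lam b \<longleftrightarrow>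
     bounded_solution c y lam b \<and>
     (\<exists>k\<ge>1. \<exists>\<gamma>>0. \<forall>s t. s \<le> t \<longrightarrow>
        exp (LBINT r=ereal s..ereal t. deriv (g c) (b r)) \<le> k * exp (- \<gamma> * (t - s)))"

text \<open>Here \<open>t \<le> s\<close>; \<open>LBINT\<close> is the oriented integral, so it changes sign when its endpoints
  are swapped.\<close>

definition hyperbolic_repulsive ::
  "real \<Rightarrow> (real \<Rightarrow> real) \<Rightarrow> real \<Rightarrow> (real \<Rightarrow> real) \<Rightarrow> bool" where
  "hyperbolic_repulsive c y lam b \<longleftrightarrow>
     bounded_solution c y lam b \<and>
     (\<exists>k\<ge>1. \<exists>\<gamma>>0. \<forall>s t. t \<le> s \<longrightarrow>
        exp (LBINT r=ereal s..ereal t. deriv (g c) (b r)) \<le> k * exp (\<gamma> * (t - s)))"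

definition bistability :: "real \<Rightarrow> (real \<Rightarrow> real) \<Rightarrow> real \<Rightarrow> bool" where
  "bistability c y lam \<longleftrightarrow>
     (\<exists>b1 b2. b1 \<noteq> b2 \<and> {b. hyperbolic_attractive c y lam b} = {b1, b2} \<and>
        uniformly_separated b1 b2 \<and> positive b1 \<and> positive b2)"

text \<open>The limit makes sense only for a solution defined up to \<open>+\<infinity>\<close>, so this is part of
  the definition.\<close>

definition attracted_to ::
  "real set \<Rightarrow> (real \<Rightarrow> real) \<Rightarrow> (real \<Rightarrow> real) \<Rightarrow> bool" where
  "attracted_to I x b \<longleftrightarrow>
     (\<exists>s. {s..} \<subseteq> I) \<and> ((\<lambda>t. b t - x t) \<longlongrightarrow> 0) at_top"

definition basins_separated ::
  "real \<Rightarrow> (real \<Rightarrow> real) \<Rightarrow> real \<Rightarrow>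
     (real \<Rightarrow> real) \<Rightarrow> (real \<Rightarrow> real) \<Rightarrow> (real \<Rightarrow> real) \<Rightarrow> bool" where
  "basins_separated c y lam l m u \<longleftrightarrow>
     (\<forall>I x. maximal_solution c y lam I x \<longrightarrow>
        ((\<exists>s\<in>I. x s > m s) \<longrightarrow> attracted_to I x u) \<and>
        ((\<exists>s\<in>I. 0 \<le> x s \<and> x s < m s) \<longrightarrow> attracted_to I x l))"

definition attractors_separated_by ::
  "real \<Rightarrow> (real \<Rightarrow> real) \<Rightarrow> real \<Rightarrow>
     (real \<Rightarrow> real) \<Rightarrow> (real \<Rightarrow> real) \<Rightarrow> (real \<Rightarrow> real) \<Rightarrow> bool" where
  "attractors_separated_by c y lam l m u \<longleftrightarrow>
     hyperbolic_attractive c y lam l \<and> hyperbolic_attractive c y lam u \<and>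
     hyperbolic_repulsive c y lam m \<and>
     (\<forall>t. l t < m t \<and> m t < u t) \<and>
     (\<forall>t. x1 c < m t \<and> m t < x2 c) \<and>
     basins_separated c y lam l m u"

definition positive_bounded_above_x2 ::
  "real \<Rightarrow> (real \<Rightarrow> real) \<Rightarrow> real \<Rightarrow> (real \<Rightarrow> real) \<Rightarrow> bool" where
  "positive_bounded_above_x2 c y lam u \<longleftrightarrow>
     bounded_solution c y lam u \<and> positive u \<and> (\<forall>t. x2 c < u t)"

definition positive_bounded_below_x1 ::
  "real \<Rightarrow> (real \<Rightarrow> real) \<Rightarrow> real \<Rightarrow> (real \<Rightarrow> real) \<Rightarrow> bool" where
  "positive_bounded_below_x1 c y lam l \<longleftrightarrow>
     bounded_solution c y lam l \<and> positive l \<and> (\<forall>t. l t < x1 c)"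

text \<open>The compact-open topology on the space of continuous real functions; taking \<open>K = {}\<close>
  shows that its carrier consists of all of them.\<close>

definition compact_open_topology :: "(real \<Rightarrow> real) topology" where
  "compact_open_topology = topology_generated_by
     {{f. continuous_on UNIV f \<and> f ` K \<subseteq> U} | K U. compact K \<and> open U}"

definition hull_of :: "(real \<Rightarrow> real) \<Rightarrow> (real \<Rightarrow> real) set" where
  "hull_of y = compact_open_topology closure_of (range (\<lambda>s t. y (t + s)))"

end

theory Submission
  imports Defs
begin

text \<open>
  The nonlinearity \<open>g c\<close> is globally Lipschitz and, on the positive half-line, decreasing on
  \<open>[0, x1 c]\<close>, increasing on \<open>[x1 c, x2 c]\<close> and decreasing beyond \<open>x2 c\<close>. On a bounded interval
  where the slope of \<open>g c\<close> is negative and bounded away from 0, solutions approach each other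
  exponentially; where it is positive and bounded away from 0, they move apart exponentially. With \<open>f t = lam + y t\<close>, the condition \<open>lambda1 c \<le> f t\<close> says precisely that the
  vector field points upwards across the level \<open>x2 c\<close>, and \<open>f t \<le> lambda2 c\<close> that it points downwards
  across \<open>x1 c\<close>. Therefore \<open>[x2 c, \<infinity>)\<close> and \<open>[0, x1 c]\<close> are forward invariant, \<open>[x1 c, x2 c]\<close> is
  backward invariant, and each contains an entire bounded solution (\<open>ordered_family_confined\<close>,
  where high levels bound the first region from above because \<open>g c x \<le> - x\<close>).

  The slope of \<open>g c\<close> vanishes at \<open>x1 c\<close> and \<open>x2 c\<close>, so hyperbolicity requires these solutions to
  keep a uniform distance from the two levels. This follows as soon as the drift across a level is
  bounded below by a positive constant during intervals of fixed length that recur with bounded gaps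
  (\<open>recurrently_positive\<close>, \<open>recurrent_gain\<close>). Such a drift is obvious if the inequalities for \<open>f\<close> hold
  with a margin. If they are not strict, but the constants \<open>INF r. y r\<close> and \<open>SUP r. y r\<close> are not in the
  hull, the definition of the compact-open topology and uniform continuity provide it
  (\<open>recurrently_positive_of_hull\<close>). The parts of the theorem thus follow from \<open>upper_attractor\<close>,
  \<open>lower_attractor\<close> and \<open>bistable\<close>.

  Away from the two levels the slope is bounded away from zero, which yields hyperbolicity,
  uniqueness and attraction. The repulsive solution \<open>m\<close> in the middle strip separates the basins, since
  a solution that stays in that strip forever must coincide with \<open>m\<close>.
\<close>

section \<open>Differential inequalities\<close>

lemma exp_growth_bound:
  fixes q :: "real \<Rightarrow> real"
  assumes "s \<le> t"
    and deriv: "\<And>r. s \<le> r \<Longrightarrow> r \<le> t \<Longrightarrow> (q has_real_derivative q' r) (at r)"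
    and le: "\<And>r. s \<le> r \<Longrightarrow> r \<le> t \<Longrightarrow> q' r \<le> k * q r"
  shows "q t \<le> q s * exp (k * (t - s))"
proof -
  have "q t * exp (- k * t) \<le> q s * exp (- k * s)"
  proof (rule DERIV_nonpos_imp_nonincreasing[OF \<open>s \<le> t\<close>])
    fix r assume r: "s \<le> r" "r \<le> t"
    have "((\<lambda>r. q r * exp (- k * r)) has_real_derivative (q' r - k * q r) * exp (- k * r)) (at r)"
      by (auto intro!: derivative_eq_intros deriv r simp: algebra_simps)
    then show "\<exists>z. ((\<lambda>r. q r * exp (- k * r)) has_real_derivative z) (at r) \<and> z \<le> 0"
      using le[OF r] by (intro exI conjI) (auto intro: mult_nonpos_nonneg)
  qed
  then have "q t * exp (- k * t) * exp (k * t) \<le> q s * exp (- k * s) * exp (k * t)"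
    by (intro mult_right_mono) auto
  then show ?thesis
    by (simp add: mult.assoc flip: exp_add) (simp add: algebra_simps)
qed

text \<open>
  The differential inequality is linear only where \<open>h\<close> keeps one sign. If \<open>h\<close> were negative at \<open>t\<close>,
  it would be negative ever since its last nonnegative time \<open>a\<close>; from then on \<open>h r * exp (- L * r)\<close>
  is nondecreasing and starts from a nonnegative value, a contradiction.
\<close>

lemma nonneg_invariant:
  fixes h :: "real \<Rightarrow> real"
  assumes "s \<le> t" "0 \<le> h s"
    and deriv: "\<And>r. s \<le> r \<Longrightarrow> r \<le> t \<Longrightarrow> (h has_real_derivative h' r) (at r)"
    and ge: "\<And>r. s \<le> r \<Longrightarrow> r \<le> t \<Longrightarrow> - L * \<bar>h r\<bar> \<le> h' r"
  shows "0 \<le> h t"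
proof (rule ccontr)
  assume neg: "\<not> 0 \<le> h t"
  have cont: "continuous_on {s..t} h"
    by (intro continuous_at_imp_continuous_on ballI DERIV_isCont) (auto intro: deriv)
  have "compact ({s..t} \<inter> h -` {0..})"
    using continuous_closed_preimage[OF cont, of "{0..}"] by (simp add: compact_eq_bounded_closed)
      (meson bounded_Int bounded_closed_interval)
  moreover have "{s..t} \<inter> h -` {0..} \<noteq> {}" using assms(1,2) by auto
  ultimately obtain a where am: "a \<in> {s..t} \<inter> h -` {0..}"
    and top: "\<forall>r\<in>{s..t} \<inter> h -` {0..}. r \<le> a"
    using compact_attains_sup by metis
  have a: "s \<le> a" "a \<le> t" "0 \<le> h a" using am by auto
  have last: "r \<le> a" if "s \<le> r" "r \<le> t" "0 \<le> h r" for r using top that by auto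
  have "a < t" using a neg by (cases "a = t") auto
  let ?q = "\<lambda>r. h r * exp (- L * r)" and ?q' = "\<lambda>r. (h' r - L * h r) * exp (- L * r)"
  have "(?q has_real_derivative ?q' r) (at r)" if "a \<le> r" "r \<le> t" for r
    using that a by (auto intro!: derivative_eq_intros deriv simp: algebra_simps)
  from MVT2[OF \<open>a < t\<close> this] obtain z where
    z: "a < z" "z < t" "?q t - ?q a = (t - a) * ?q' z" by blast
  have "h z < 0" using last[of z] z a by force
  then have "0 \<le> h' z - L * h z" using ge[of z] z a by simp
  then have "0 \<le> ?q t - ?q a" using z by simp
  moreover have "?q t < 0" "0 \<le> ?q a" using neg a by (auto simp: mult_neg_pos)
  ultimately show False by linarith
qed

text \<open>
  Every time window of length \<open>W\<close> meets a bump of \<open>\<phi>\<close> of fixed width and height. This single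
  notion covers both kinds of forcing in the theorem: a forcing that stays a fixed distance away from
  the critical value, and a forcing that may touch it but does not have the corresponding constant in
  its hull.
\<close>

definition recurrently_positive :: "(real \<Rightarrow> real) \<Rightarrow> bool" where
  "recurrently_positive \<phi> \<longleftrightarrow> (\<forall>t. 0 \<le> \<phi> t) \<and>
     (\<exists>W>0. \<exists>\<delta>>0. \<exists>\<epsilon>>0. \<forall>s. \<exists>a\<in>{s..s + W}. \<forall>r\<in>{a..a + \<delta>}. \<epsilon> \<le> \<phi> r)"

lemma recurrently_positiveD: "recurrently_positive \<phi> \<Longrightarrow> 0 \<le> \<phi> t"
  by (simp add: recurrently_positive_def)

lemma recurrently_positive_reflect:
  assumes "recurrently_positive \<phi>"
  shows "recurrently_positive (\<lambda>t. \<phi> (- t))"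
proof -
  obtain W \<delta> \<epsilon> where pos: "0 < W" "0 < \<delta>" "0 < \<epsilon>"
    and bump: "\<forall>s. \<exists>a\<in>{s..s + W}. \<forall>r\<in>{a..a + \<delta>}. \<epsilon> \<le> \<phi> r"
    using assms by (auto simp: recurrently_positive_def)
  have "\<exists>a\<in>{s..s + W}. \<forall>r\<in>{a..a + \<delta>}. \<epsilon> \<le> \<phi> (- r)" for s
  proof -
    obtain a where "a \<in> {- s - W - \<delta>..- s - W - \<delta> + W}" "\<forall>r\<in>{a..a + \<delta>}. \<epsilon> \<le> \<phi> r"
      using bump by blast
    then show ?thesis by (intro bexI[of _ "- a - \<delta>"]) auto
  qed
  then show ?thesis
    using assms pos unfolding recurrently_positive_def by blast
qed

lemma recurrently_positive_const_bound:
  assumes "0 < \<epsilon>" "\<And>t. \<epsilon> \<le> \<phi> t"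
  shows "recurrently_positive \<phi>"
proof -
  have "\<forall>t. 0 \<le> \<phi> t" using assms by (meson less_imp_le order_trans)
  moreover have "\<forall>s. \<exists>a\<in>{s..s + (1::real)}. \<forall>r\<in>{a..a + 1}. \<epsilon> \<le> \<phi> r" using assms(2) by force
  ultimately show ?thesis unfolding recurrently_positive_def using assms(1) zero_less_one by blast
qed

text \<open>
  Once \<open>h\<close> is nonnegative, \<open>h r * exp (L * r)\<close> is nondecreasing, and across the bump it gains at least
  the width times the height times \<open>exp (L * s)\<close>.
\<close>

lemma bump_gain:
  fixes h :: "real \<Rightarrow> real"
  assumes "0 \<le> L" "0 < \<delta>" "0 < \<epsilon>" "s \<le> a" "a + \<delta> \<le> t" "0 \<le> h s"
    and deriv: "\<And>r. (h has_real_derivative h' r) (at r)"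
    and ge: "\<And>r. \<phi> r - L * \<bar>h r\<bar> \<le> h' r"
    and nonneg: "\<And>r. 0 \<le> \<phi> r"
    and bump: "\<And>r. a \<le> r \<Longrightarrow> r \<le> a + \<delta> \<Longrightarrow> \<epsilon> \<le> \<phi> r"
  shows "\<delta> * \<epsilon> * exp (- L * (t - s)) \<le> h t"
proof -
  let ?q = "\<lambda>r. h r * exp (L * r)" and ?q' = "\<lambda>r. (h' r + L * h r) * exp (L * r)"
  have h: "0 \<le> h r" if "s \<le> r" for r
  proof (rule nonneg_invariant[OF that \<open>0 \<le> h s\<close> deriv])
    show "- L * \<bar>h r\<bar> \<le> h' r" for r using ge[of r] nonneg[of r] by simp
  qed
  have q: "(?q has_real_derivative ?q' r) (at r)" for r
    by (auto intro!: derivative_eq_intros deriv simp: algebra_simps)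
  have q': "\<phi> r * exp (L * r) \<le> ?q' r" if "s \<le> r" for r
    using ge[of r] h[OF that] by (intro mult_right_mono) auto
  obtain z where z: "a < z" "z < a + \<delta>" "?q (a + \<delta>) - ?q a = (a + \<delta> - a) * ?q' z"
    using MVT2[of a "a + \<delta>", OF _ q] \<open>0 < \<delta>\<close> by auto
  have "\<epsilon> * exp (L * s) \<le> \<phi> z * exp (L * z)"
    using bump[of z] z \<open>0 < \<epsilon>\<close> \<open>s \<le> a\<close> \<open>0 \<le> L\<close> by (intro mult_mono) (auto intro: mult_left_mono)
  also have "\<dots> \<le> ?q' z" using q' z \<open>s \<le> a\<close> by simp
  finally have "\<delta> * (\<epsilon> * exp (L * s)) \<le> ?q (a + \<delta>) - ?q a"
    using z \<open>0 < \<delta>\<close> by simp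
  moreover have "0 \<le> ?q a" using h \<open>s \<le> a\<close> by simp
  moreover have "?q (a + \<delta>) \<le> ?q t"
  proof (rule DERIV_nonneg_imp_nondecreasing[OF \<open>a + \<delta> \<le> t\<close>])
    fix r assume "a + \<delta> \<le> r"
    then have "s \<le> r" using \<open>s \<le> a\<close> \<open>0 < \<delta>\<close> by linarith
    moreover have "0 \<le> \<phi> r * exp (L * r)" using nonneg by simp
    ultimately have "0 \<le> ?q' r" using q'[of r] by linarith
    then show "\<exists>y. (?q has_real_derivative y) (at r) \<and> 0 \<le> y" using q by blast
  qed
  ultimately have "\<delta> * \<epsilon> * exp (L * s) \<le> h t * exp (L * t)" by simp
  then have "\<delta> * \<epsilon> * exp (L * s) * exp (- L * t) \<le> h t * exp (L * t) * exp (- L * t)"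
    by (intro mult_right_mono) auto
  then show ?thesis
    by (simp add: mult.assoc flip: exp_add) (simp add: algebra_simps)
qed

text \<open>
  A nonnegative \<open>h\<close> driven by a recurrently positive term is not only kept nonnegative: after one
  window it exceeds a constant that depends neither on \<open>h\<close> nor on the time. Restarting the estimate
  one window before \<open>t\<close> removes the dependence on the elapsed time. This uniform gap is the source of
  all hyperbolicity statements below.
\<close>

lemma recurrent_gain:
  assumes "recurrently_positive \<phi>" "0 \<le> L"
  obtains W \<rho> where "0 < W" "0 < \<rho>"
    "\<And>h h' s t. (\<And>r. (h has_real_derivative h' r) (at r)) \<Longrightarrow>
       (\<And>r. \<phi> r - L * \<bar>h r\<bar> \<le> h' r) \<Longrightarrow> 0 \<le> h s \<Longrightarrow> s + W \<le> t \<Longrightarrow> \<rho> \<le> h t"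
proof -
  obtain W \<delta> \<epsilon> where pos: "0 < W" "0 < \<delta>" "0 < \<epsilon>"
    and bump: "\<forall>s. \<exists>a\<in>{s..s + W}. \<forall>r\<in>{a..a + \<delta>}. \<epsilon> \<le> \<phi> r"
    using assms by (auto simp: recurrently_positive_def)
  show ?thesis
  proof (rule that[of "W + \<delta>" "\<delta> * \<epsilon> * exp (- L * (W + \<delta>))"])
    fix h h' :: "real \<Rightarrow> real" and s t :: real
    assume deriv: "\<And>r. (h has_real_derivative h' r) (at r)"
      and ge: "\<And>r. \<phi> r - L * \<bar>h r\<bar> \<le> h' r" and s: "0 \<le> h s" "s + (W + \<delta>) \<le> t"
    define s' where "s' = t - (W + \<delta>)"
    have "0 \<le> h s'"
    proof (rule nonneg_invariant[OF _ s(1) deriv])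
      show "s \<le> s'" using s s'_def by simp
      show "- L * \<bar>h r\<bar> \<le> h' r" for r
        using ge[of r] recurrently_positiveD[OF assms(1), of r] by simp
    qed
    moreover obtain a where "a \<in> {s'..s' + W}" "\<forall>r\<in>{a..a + \<delta>}. \<epsilon> \<le> \<phi> r"
      using bump by blast
    ultimately have "\<delta> * \<epsilon> * exp (- L * (t - s')) \<le> h t"
      using pos by (intro bump_gain[OF assms(2), where a = a and \<phi> = \<phi> and h' = h'] deriv ge
          recurrently_positiveD[OF assms(1)]) (auto simp: s'_def)
    then show "\<delta> * \<epsilon> * exp (- L * (W + \<delta>)) \<le> h t" by (simp add: s'_def)
  qed (use pos in auto)
qed

section \<open>Global solutions of scalar Lipschitz equations\<close>

lemma antiderivative_exists:
  fixes h :: "real \<Rightarrow> real"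
  assumes "continuous_on UNIV h"
  shows "\<exists>H. H 0 = 0 \<and> (\<forall>t. (H has_real_derivative h t) (at t))"
proof -
  have "isCont h t" for t using assms by (simp add: continuous_on_eq_continuous_at)
  then obtain F where F: "\<And>t. (F has_real_derivative h t) (at t)"
    using einterval_antiderivative[of "-\<infinity>" "\<infinity>" h]
    by (auto simp: has_real_derivative_iff_has_vector_derivative)
  have "((\<lambda>t. F t - F 0) has_real_derivative h t) (at t)" for t
    using DERIV_diff[OF F DERIV_const] by simp
  then show ?thesis by (intro exI[of _ "\<lambda>t. F t - F 0"]) simp
qed

text \<open>
  Antiderivatives of functions dominated by the weight \<open>exp (K * \<bar>t\<bar>)\<close> are dominated by it again, with
  a gain of \<open>1 / K\<close>; for large \<open>K\<close> this turns the Picard operator into a contraction.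
\<close>

lemma exp_weighted_bound:
  fixes H :: "real \<Rightarrow> real"
  assumes "0 < K" "H 0 = 0"
    and deriv: "\<And>t. (H has_real_derivative h t) (at t)"
    and bound: "\<And>t. \<bar>h t\<bar> \<le> A * exp (K * \<bar>t\<bar>)"
  shows "\<bar>H t\<bar> \<le> A / K * exp (K * \<bar>t\<bar>)"
proof -
  have "0 \<le> A" using bound[of 0] by simp
  have forward: "H t \<le> A / K * exp (K * t)"
    if "0 \<le> t" "H 0 = 0" "\<And>t. (H has_real_derivative h t) (at t)"
      "\<And>t. \<bar>h t\<bar> \<le> A * exp (K * \<bar>t\<bar>)" for H h t
  proof -
    have "A / K * exp (K * 0) - H 0 \<le> A / K * exp (K * t) - H t"
    proof (rule DERIV_nonneg_imp_nondecreasing[OF \<open>0 \<le> t\<close>])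
      fix r :: real assume "0 \<le> r"
      have "((\<lambda>r. A / K * exp (K * r) - H r) has_real_derivative A * exp (K * r) - h r) (at r)"
        using \<open>0 < K\<close> by (auto intro!: derivative_eq_intros that(3))
      moreover have "0 \<le> A * exp (K * r) - h r" using that(4)[of r] \<open>0 \<le> r\<close> by simp
      ultimately show "\<exists>z. ((\<lambda>r. A / K * exp (K * r) - H r) has_real_derivative z) (at r) \<and> 0 \<le> z"
        by blast
    qed
    moreover have "0 \<le> A / K" using \<open>0 \<le> A\<close> \<open>0 < K\<close> by simp
    ultimately show ?thesis using that(2) by simp
  qed
  have neg: "((\<lambda>t. - H t) has_real_derivative - h t) (at t)" for t
    by (intro DERIV_minus deriv)
  have refl: "((\<lambda>t. H (- t)) has_real_derivative - h (- t)) (at t)" for t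
    using DERIV_mirror[of H "h (- t)" t] deriv[of "- t"] by simp
  have refl_neg: "((\<lambda>t. - H (- t)) has_real_derivative h (- t)) (at t)" for t
    using DERIV_minus[OF refl, of t] by simp
  show ?thesis
  proof (cases "0 \<le> t")
    case True
    then show ?thesis
      using forward[OF _ _ deriv, of t] forward[OF _ _ neg, of t] \<open>H 0 = 0\<close> bound by auto
  next
    case False
    then show ?thesis
      using forward[OF _ _ refl, of "- t"] forward[OF _ _ refl_neg, of "- t"] \<open>H 0 = 0\<close>
      bound by (metis abs_ge_zero abs_le_iff abs_minus_cancel abs_of_neg linorder_not_le minus_zero
          neg_0_le_iff_le minus_minus less_imp_le)
  qed
qed

text \<open>
  Picard iteration on the whole line at once. In the norm with weight \<open>exp (2 * L * \<bar>t\<bar>)\<close> the integral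
  operator contracts with factor one half, so Banach's theorem yields a solution on all of \<open>\<real>\<close>
  without continuation arguments. A fixed point \<open>\<phi>\<close> represents the solution \<open>w t * \<phi> t\<close>.
\<close>

lemma global_solution_at_0:
  fixes f G :: "real \<Rightarrow> real"
  assumes "0 < L" and f_cont: "continuous_on UNIV f" and f_bound: "\<And>t. \<bar>f t\<bar> \<le> B"
    and lip: "\<And>a b. \<bar>G a - G b\<bar> \<le> L * \<bar>a - b\<bar>"
  shows "\<exists>x. x 0 = v \<and> (\<forall>t. (x has_real_derivative f t + G (x t)) (at t))"
proof -
  \<comment> \<open>The rate \<open>2 * L\<close> makes the contraction constant \<open>L / K\<close> equal to one half.\<close>
  define K where "K = 2 * L"
  have "0 < K" using \<open>0 < L\<close> by (simp add: K_def)
  define w where "w t = exp (K * \<bar>t\<bar>)" for t :: real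
  have w: "1 \<le> w t" for t using \<open>0 < K\<close> by (simp add: w_def)
  have w_pos: "0 < w t" for t by (simp add: w_def)
  have w_cont: "continuous_on UNIV w" unfolding w_def by (intro continuous_intros)
  have G_cont: "continuous_on UNIV G"
  proof (rule uniformly_continuous_imp_continuous, rule lipschitz_on_uniformly_continuous)
    show "L-lipschitz_on UNIV G"
      using \<open>0 < L\<close> lip by (intro lipschitz_onI) (auto simp: dist_real_def)
  qed
  define rhs where "rhs \<phi> t = f t + G (w t * apply_bcontfun \<phi> t)" for \<phi> :: "real \<Rightarrow>\<^sub>C real" and t
  have rhs_cont: "continuous_on UNIV (rhs \<phi>)" for \<phi>
    unfolding rhs_def by (intro continuous_intros f_cont w_cont continuous_on_compose2[OF G_cont]) auto
  have rhs_bound: "\<bar>rhs \<phi> t\<bar> \<le> (B + \<bar>G 0\<bar> + L * norm \<phi>) * w t" for \<phi> t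
  proof -
    have "\<bar>rhs \<phi> t\<bar> \<le> B + \<bar>G 0\<bar> + L * \<bar>w t * apply_bcontfun \<phi> t\<bar>"
      using f_bound[of t] lip[of "w t * apply_bcontfun \<phi> t" 0] by (auto simp: rhs_def)
    also have "L * \<bar>w t * apply_bcontfun \<phi> t\<bar> \<le> L * (norm \<phi> * w t)"
      using norm_bounded[of \<phi> t] w_pos[of t] \<open>0 < L\<close> by (simp add: abs_mult)
    also have "B + \<bar>G 0\<bar> \<le> (B + \<bar>G 0\<bar>) * w t"
      using mult_left_mono[OF w[of t], of "B + \<bar>G 0\<bar>"] f_bound[of 0] by simp
    finally show ?thesis by (simp add: algebra_simps)
  qed
  define P where "P \<phi> = (SOME H. H 0 = 0 \<and> (\<forall>t. (H has_real_derivative rhs \<phi> t) (at t)))" for \<phi>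
  have P: "P \<phi> 0 = 0" "(P \<phi> has_real_derivative rhs \<phi> t) (at t)" for \<phi> t
    using someI_ex[OF antiderivative_exists[OF rhs_cont[of \<phi>]]] unfolding P_def by auto
  define T where "T \<phi> = Bcontfun (\<lambda>t. (v + P \<phi> t) / w t)" for \<phi>
  have T: "apply_bcontfun (T \<phi>) t = (v + P \<phi> t) / w t" for \<phi> t
  proof -
    have "(\<lambda>t. (v + P \<phi> t) / w t) \<in> bcontfun"
    proof (rule bcontfun_normI)
      have "continuous_on UNIV (P \<phi>)"
        by (intro continuous_at_imp_continuous_on ballI DERIV_isCont) (rule P(2))
      then show "continuous_on UNIV (\<lambda>t. (v + P \<phi> t) / w t)"
        using w_pos by (intro continuous_intros w_cont) (auto simp: less_imp_neq[symmetric])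
      show "norm ((v + P \<phi> t) / w t) \<le> \<bar>v\<bar> + (B + \<bar>G 0\<bar> + L * norm \<phi>) / K" for t
      proof -
        have "\<bar>P \<phi> t\<bar> \<le> (B + \<bar>G 0\<bar> + L * norm \<phi>) / K * w t"
          using exp_weighted_bound[OF \<open>0 < K\<close> P, of \<phi>] rhs_bound by (simp add: w_def)
        moreover have "\<bar>v\<bar> \<le> \<bar>v\<bar> * w t" using w[of t] by (simp add: mult_le_cancel_left1)
        ultimately have "\<bar>v + P \<phi> t\<bar> \<le> (\<bar>v\<bar> + (B + \<bar>G 0\<bar> + L * norm \<phi>) / K) * w t"
          by (simp add: distrib_right)
        then show ?thesis using w_pos[of t] by (simp add: divide_le_eq)
      qed
    qed
    then show ?thesis by (simp add: T_def Bcontfun_inverse)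
  qed
  have "\<exists>!\<phi>. T \<phi> = \<phi>"
  proof (rule banach_fix_type[of "1/2"], safe)
    fix \<phi> \<psi>
    show "dist (T \<phi>) (T \<psi>) \<le> 1/2 * dist \<phi> \<psi>"
    proof (rule dist_bound)
      fix t
      have "\<bar>rhs \<phi> t - rhs \<psi> t\<bar> \<le> L * dist \<phi> \<psi> * w t" for t
      proof -
        have "\<bar>rhs \<phi> t - rhs \<psi> t\<bar> \<le> L * \<bar>w t * (apply_bcontfun \<phi> t - apply_bcontfun \<psi> t)\<bar>"
          using lip[of "w t * apply_bcontfun \<phi> t" "w t * apply_bcontfun \<psi> t"]
          by (simp add: rhs_def algebra_simps)
        also have "\<dots> \<le> L * (w t * dist \<phi> \<psi>)"
          using dist_bounded[of \<phi> t \<psi>] w_pos[of t] \<open>0 < L\<close>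
          by (simp add: abs_mult dist_real_def)
        finally show ?thesis by (simp add: mult_ac)
      qed
      then have "\<bar>P \<phi> t - P \<psi> t\<bar> \<le> L * dist \<phi> \<psi> / K * w t"
        using exp_weighted_bound[OF \<open>0 < K\<close>, of "\<lambda>t. P \<phi> t - P \<psi> t" "\<lambda>t. rhs \<phi> t - rhs \<psi> t"
            "L * dist \<phi> \<psi>"]
        by (simp add: w_def P DERIV_diff)
      moreover have "dist (apply_bcontfun (T \<phi>) t) (apply_bcontfun (T \<psi>) t) = \<bar>P \<phi> t - P \<psi> t\<bar> / w t"
        using w_pos[of t] by (simp add: T dist_real_def flip: diff_divide_distrib)
      ultimately show "dist (apply_bcontfun (T \<phi>) t) (apply_bcontfun (T \<psi>) t) \<le> 1/2 * dist \<phi> \<psi>"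
        using w_pos[of t] \<open>0 < L\<close> by (simp add: K_def divide_le_eq)
    qed
  qed auto
  then obtain \<phi> where fixp: "T \<phi> = \<phi>" by blast
  let ?x = "\<lambda>t. v + P \<phi> t"
  have x: "w t * apply_bcontfun \<phi> t = ?x t" for t
    using T[of \<phi> t] fixp w_pos[of t] by (simp add: field_simps)
  have "(?x has_real_derivative f t + G (?x t)) (at t)" for t
    using DERIV_add[OF DERIV_const P(2), of v \<phi> t] by (simp add: rhs_def x)
  then show ?thesis using P(1) by (intro exI[of _ ?x]) simp
qed

lemma global_solution_exists:
  fixes f G :: "real \<Rightarrow> real"
  assumes "0 < L" and f_cont: "continuous_on UNIV f" and f_bound: "\<And>t. \<bar>f t\<bar> \<le> B"
    and lip: "\<And>a b. \<bar>G a - G b\<bar> \<le> L * \<bar>a - b\<bar>"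
  shows "\<exists>x. x s = v \<and> (\<forall>t. (x has_real_derivative f t + G (x t)) (at t))"
proof -
  have "continuous_on UNIV (\<lambda>t. f (t + s))"
    by (intro continuous_on_compose2[OF f_cont] continuous_intros) auto
  from global_solution_at_0[OF \<open>0 < L\<close> this f_bound lip]
  obtain x where x: "x 0 = v" "\<And>t. (x has_real_derivative f (t + s) + G (x t)) (at t)" by blast
  have "((\<lambda>t. x (t - s)) has_real_derivative f t + G (x (t - s))) (at t)" for t
    using x(2)[of "t - s"] DERIV_shift[of "\<lambda>t. x (t - s)" _ "t - s" s] by simp
  then show ?thesis using x(1) by (intro exI[of _ "\<lambda>t. x (t - s)"]) simp
qed

section \<open>Entire curves in invariant strips\<close>

text \<open>
  Existence of an entire curve in a strip that is invariant only in forward time. Curves that start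
  on the lower edge at a remote time reach time 0 below those that start on the upper edge, whatever
  the two starting times are. The supremum of the former values at time 0 is therefore an initial
  value whose curve, by order preservation, lies between both edges at every time. Applied to the
  time-reversed family, this gives curves in strips that are invariant in backward time.
\<close>

lemma ordered_family_confined:
  fixes S :: "(real \<Rightarrow> real) set" and a b :: real
  assumes through: "\<And>s v. \<exists>z\<in>S. z s = v"
    and ordered: "\<And>z w s t. z \<in> S \<Longrightarrow> w \<in> S \<Longrightarrow> z s \<le> w s \<Longrightarrow> z t \<le> w t"
    and invariant: "\<And>z s t. z \<in> S \<Longrightarrow> z s \<in> {a..b} \<Longrightarrow> s \<le> t \<Longrightarrow> z t \<in> {a..b}"
    and "a \<le> b"
  shows "\<exists>u\<in>S. \<forall>t. u t \<in> {a..b}"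
proof -
  obtain lo where lo: "\<And>s. lo s \<in> S" "\<And>s. lo s s = a"
    using choice[of "\<lambda>s z. z \<in> S \<and> z s = a"] through by blast
  obtain hi where hi: "\<And>s. hi s \<in> S" "\<And>s. hi s s = b"
    using choice[of "\<lambda>s z. z \<in> S \<and> z s = b"] through by blast
  have lo_le_hi: "lo s 0 \<le> hi t 0" for s t
  proof (cases "s \<le> t")
    case True
    then have "lo s t \<in> {a..b}" using invariant[OF lo(1), of s s t] lo(2) \<open>a \<le> b\<close> by simp
    then show ?thesis using ordered[OF lo(1) hi(1), of s t t 0] hi(2) by simp
  next
    case False
    then have "hi t s \<in> {a..b}" using invariant[OF hi(1), of t t s] hi(2) \<open>a \<le> b\<close> by simp
    then show ?thesis using ordered[OF lo(1) hi(1), of s s t 0] lo(2) by simp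
  qed
  define p where "p = (SUP s. lo s 0)"
  have "lo s 0 \<le> p" for s
    unfolding p_def using lo_le_hi[of _ 0] by (intro cSUP_upper bdd_aboveI2) auto
  moreover have "p \<le> hi t 0" for t
    unfolding p_def using lo_le_hi by (intro cSUP_least) auto
  moreover obtain u where "u \<in> S" "u 0 = p" using through by blast
  ultimately have "a \<le> u t" "u t \<le> b" for t
    using ordered[OF lo(1) \<open>u \<in> S\<close>, of t 0 t] ordered[OF \<open>u \<in> S\<close> hi(1), of 0 t t] lo(2) hi(2) by auto
  then show ?thesis using \<open>u \<in> S\<close> by auto
qed

section \<open>Functions whose hull avoids a constant\<close>

lemma compact_open_nbhd_const:
  assumes "openin compact_open_topology T" "(\<lambda>t. a) \<in> T"
  shows "\<exists>R>0. \<exists>\<epsilon>>0. \<forall>f. continuous_on UNIV f \<longrightarrow> (\<forall>t\<in>{-R..R}. \<bar>f t - a\<bar> < \<epsilon>) \<longrightarrow> f \<in> T"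
proof -
  have "generate_topology_on {{f. continuous_on UNIV f \<and> f ` K \<subseteq> U} | K U. compact K \<and> open U} T"
    using assms(1) unfolding compact_open_topology_def openin_topology_generated_by_iff .
  then show ?thesis using assms(2)
  proof (induction rule: generate_topology_on.induct)
    case Empty
    then show ?case by simp
  next
    case (Int A B)
    then obtain R \<epsilon> R' \<epsilon>' where A: "0 < R" "0 < \<epsilon>"
      "\<forall>f. continuous_on UNIV f \<longrightarrow> (\<forall>t\<in>{-R..R}. \<bar>f t - a\<bar> < \<epsilon>) \<longrightarrow> f \<in> A"
      and B: "0 < R'" "0 < \<epsilon>'"
      "\<forall>f. continuous_on UNIV f \<longrightarrow> (\<forall>t\<in>{-R'..R'}. \<bar>f t - a\<bar> < \<epsilon>') \<longrightarrow> f \<in> B"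
      by auto
    have "f \<in> A \<inter> B" if f: "continuous_on UNIV f"
      and near: "\<forall>t\<in>{- max R R'..max R R'}. \<bar>f t - a\<bar> < min \<epsilon> \<epsilon>'" for f
    proof -
      have "\<forall>t\<in>{-R..R}. \<bar>f t - a\<bar> < \<epsilon>" "\<forall>t\<in>{-R'..R'}. \<bar>f t - a\<bar> < \<epsilon>'"
        using near by force+
      then show ?thesis using A(3) B(3) f by blast
    qed
    moreover have "0 < max R R'" "0 < min \<epsilon> \<epsilon>'" using A B by auto
    ultimately show ?case by blast
  next
    case (UN \<K>)
    then obtain k where "k \<in> \<K>" "(\<lambda>t. a) \<in> k" by blast
    then show ?case using UN.IH[of k] by blast
  next
    case (Basis A)
    then obtain K U where A: "A = {f. continuous_on UNIV f \<and> f ` K \<subseteq> U}" "compact K" "open U"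
      by blast
    obtain R where R: "0 < R" "K \<subseteq> {-R..R}"
      using compact_imp_bounded[OF A(2)] unfolding bounded_pos by (force simp: abs_le_iff)
    show ?case
    proof (cases "K = {}")
      case True
      then show ?thesis using A(1) zero_less_one by blast
    next
      case False
      then have "a \<in> U" using Basis A(1) by auto
      then obtain \<epsilon> where "0 < \<epsilon>" "ball a \<epsilon> \<subseteq> U" using A(3) openE by blast
      have "f \<in> A" if f: "continuous_on UNIV f" and near: "\<forall>t\<in>{-R..R}. \<bar>f t - a\<bar> < \<epsilon>" for f
      proof -
        have "f t \<in> ball a \<epsilon>" if "t \<in> K" for t
          using near R(2) that by (auto simp: dist_real_def abs_minus_commute)
        then show ?thesis using A(1) f \<open>ball a \<epsilon> \<subseteq> U\<close> by blast
      qed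
      then show ?thesis using R(1) \<open>0 < \<epsilon>\<close> by blast
    qed
  qed
qed

text \<open>
  A basic neighbourhood of a constant in the compact-open topology is a uniform neighbourhood on a
  compact interval. Avoiding it along all translates means that deviations from the constant recur
  with bounded gaps.
\<close>

lemma const_notin_hull_imp_far:
  assumes "continuous_on UNIV y" "(\<lambda>t. a) \<notin> hull_of y"
  obtains R \<epsilon> where "0 < R" "0 < \<epsilon>" "\<And>s. \<exists>t\<in>{s - R..s + R}. \<epsilon> \<le> \<bar>y t - a\<bar>"
proof -
  have "openin compact_open_topology {f. continuous_on UNIV f \<and> f ` {} \<subseteq> UNIV}"
    unfolding compact_open_topology_def
    by (rule topology_generated_by_Basis) (use compact_empty open_UNIV in blast)
  then have "(\<lambda>t. a) \<in> topspace compact_open_topology"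
    using openin_subset by fastforce
  then obtain T where T: "openin compact_open_topology T" "(\<lambda>t. a) \<in> T"
    "\<And>s. (\<lambda>t. y (t + s)) \<notin> T"
    using assms(2) unfolding hull_of_def in_closure_of by blast
  obtain R \<epsilon> where R: "0 < R" "0 < \<epsilon>"
    "\<forall>f. continuous_on UNIV f \<longrightarrow> (\<forall>t\<in>{-R..R}. \<bar>f t - a\<bar> < \<epsilon>) \<longrightarrow> f \<in> T"
    using compact_open_nbhd_const[OF T(1,2)] by blast
  have "\<exists>t\<in>{s - R..s + R}. \<epsilon> \<le> \<bar>y t - a\<bar>" for s
  proof -
    have "continuous_on UNIV (\<lambda>t. y (t + s))"
      by (intro continuous_on_compose2[OF assms(1)] continuous_intros) auto
    then obtain t where "t \<in> {-R..R}" "\<not> \<bar>y (t + s) - a\<bar> < \<epsilon>" using R(3) T(3) by blast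
    then show ?thesis by (intro bexI[of _ "t + s"]) auto
  qed
  then show ?thesis using that R by blast
qed

text \<open>
  Uniform continuity widens each recurring deviation to a bump of fixed width.
\<close>

lemma recurrently_positive_of_hull:
  assumes uc: "uniformly_continuous_on UNIV y" and hull: "(\<lambda>t. a) \<notin> hull_of y"
    and nonneg: "\<And>t. 0 \<le> \<phi> t" and far: "\<And>t. \<bar>y t - a\<bar> \<le> \<phi> t"
  shows "recurrently_positive \<phi>"
proof -
  obtain R \<epsilon> where R: "0 < R" "0 < \<epsilon>" "\<And>s. \<exists>t\<in>{s - R..s + R}. \<epsilon> \<le> \<bar>y t - a\<bar>"
    using const_notin_hull_imp_far[OF uniformly_continuous_imp_continuous[OF uc] hull] by metis
  obtain \<delta> where \<delta>: "0 < \<delta>" "\<And>t r. dist r t < \<delta> \<Longrightarrow> dist (y r) (y t) < \<epsilon> / 2"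
    using uc R(2) unfolding uniformly_continuous_on_def by (metis UNIV_I half_gt_zero)
  have "\<exists>t\<in>{s..s + 2 * R}. \<forall>r\<in>{t..t + \<delta> / 2}. \<epsilon> / 2 \<le> \<phi> r" for s
  proof -
    obtain t where t: "t \<in> {s + R - R..s + R + R}" "\<epsilon> \<le> \<bar>y t - a\<bar>" using R(3) by blast
    have "\<epsilon> / 2 \<le> \<phi> r" if "r \<in> {t..t + \<delta> / 2}" for r
      proof -
      have "\<bar>y r - y t\<bar> < \<epsilon> / 2"
        using \<delta>(2)[of r t] that \<delta>(1) by (auto simp: dist_real_def abs_minus_commute)
      then show ?thesis using t(2) far[of r] by linarith
    qed
    then show ?thesis using t(1) by (intro bexI[of _ t]) auto
  qed
  moreover have "0 < 2 * R" "0 < \<delta> / 2" "0 < \<epsilon> / 2" using R \<delta> by auto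
  ultimately show ?thesis unfolding recurrently_positive_def using nonneg by blast
qed

section \<open>The nonlinearity\<close>

lemma g_zero: "g c 0 = 0"
  by (simp add: g_def)

lemma g_le_neg: "0 \<le> c \<Longrightarrow> 0 \<le> x \<Longrightarrow> g c x \<le> - x"
  by (simp add: g_def)

lemma g_nonneg_left: "0 \<le> c \<Longrightarrow> x \<le> 0 \<Longrightarrow> 0 \<le> g c x"
  unfolding g_def
  using mult_nonneg_nonpos[of "2 * c" "x / (1 + x\<^sup>2)"] divide_nonpos_pos[of x "1 + x\<^sup>2"]
    zero_le_power2[of x] by linarith

lemma one_plus_square_pos: "0 < 1 + x\<^sup>2" for x :: real
  by (simp add: add_pos_nonneg)

lemma g_has_deriv: "(g c has_real_derivative - 1 - 2 * c * (1 - x\<^sup>2) / (1 + x\<^sup>2)\<^sup>2) (at x)"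
proof -
  have nz: "1 + x\<^sup>2 \<noteq> 0" using one_plus_square_pos[of x] by simp
  have "((\<lambda>x. x / (1 + x\<^sup>2)) has_real_derivative
      (1 * (1 + x\<^sup>2) - x * (2 * x)) / ((1 + x\<^sup>2) * (1 + x\<^sup>2))) (at x)"
    by (rule DERIV_divide) (use nz in \<open>auto intro!: derivative_eq_intros\<close>)
  then have "((\<lambda>x. - x - 2 * c * (x / (1 + x\<^sup>2))) has_real_derivative
      - 1 - 2 * c * ((1 * (1 + x\<^sup>2) - x * (2 * x)) / ((1 + x\<^sup>2) * (1 + x\<^sup>2)))) (at x)"
    by (intro DERIV_diff DERIV_minus DERIV_cmult DERIV_ident)
  moreover have "g c = (\<lambda>x. - x - 2 * c * (x / (1 + x\<^sup>2)))" by (auto simp: g_def)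
  moreover have "1 * (1 + x\<^sup>2) - x * (2 * x) = 1 - x\<^sup>2" by (simp add: power2_eq_square)
  ultimately show ?thesis by (simp add: power2_eq_square)
qed

lemma deriv_g: "deriv (g c) x = - 1 - 2 * c * (1 - x\<^sup>2) / (1 + x\<^sup>2)\<^sup>2"
  by (rule DERIV_imp_deriv[OF g_has_deriv])

lemma g_DERIV: "(g c has_real_derivative deriv (g c) x) (at x)"
  using g_has_deriv by (simp add: deriv_g)

lemma continuous_on_deriv_g: "continuous_on S (deriv (g c))"
proof -
  have "(1 + x\<^sup>2)\<^sup>2 \<noteq> 0" for x :: real using one_plus_square_pos[of x] by simp
  then have "continuous_on S (\<lambda>x. - 1 - 2 * c * (1 - x\<^sup>2) / (1 + x\<^sup>2)\<^sup>2)"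
    by (intro continuous_intros) auto
  then show ?thesis by (simp add: deriv_g[abs_def])
qed

lemma deriv_g_bounds:
  assumes "0 \<le> c"
  shows "\<bar>deriv (g c) x\<bar> \<le> 1 + 2 * c"
proof -
  have pos: "0 < (1 + x\<^sup>2)\<^sup>2" using one_plus_square_pos[of x] by simp
  have "\<bar>1 - x\<^sup>2\<bar> \<le> (1 + x\<^sup>2) * 1" by (simp add: abs_le_iff)
  also have "\<dots> \<le> (1 + x\<^sup>2)\<^sup>2"
    unfolding power2_eq_square[of "1 + x\<^sup>2"] by (intro mult_left_mono) auto
  finally have "\<bar>(1 - x\<^sup>2) / (1 + x\<^sup>2)\<^sup>2\<bar> \<le> 1"
    using pos by (simp add: abs_mult divide_le_eq)
  then have "\<bar>2 * c * ((1 - x\<^sup>2) / (1 + x\<^sup>2)\<^sup>2)\<bar> \<le> 2 * c"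
    using assms mult_left_le[of "\<bar>(1 - x\<^sup>2) / (1 + x\<^sup>2)\<^sup>2\<bar>" "2 * c"] by (simp only: abs_mult) simp
  then show ?thesis unfolding deriv_g times_divide_eq_right[symmetric] by linarith
qed

lemma g_lipschitz:
  assumes "0 \<le> c"
  shows "\<bar>g c p - g c q\<bar> \<le> (1 + 2 * c) * \<bar>p - q\<bar>"
  using field_differentiable_bound[of UNIV "g c" "deriv (g c)" "1 + 2 * c" p q]
    g_DERIV deriv_g_bounds[OF assms] by (simp add: abs_minus_commute)

lemma secant_slope:
  assumes "p \<in> {a..b}" "q \<in> {a..b}"
  shows "\<exists>z\<in>{a..b}. (p - q) * (g c p - g c q) = deriv (g c) z * (p - q)\<^sup>2"
proof -
  have *: "\<exists>z\<in>{a..b}. (q - p) * (g c q - g c p) = deriv (g c) z * (q - p)\<^sup>2"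
    if "p < q" "p \<in> {a..b}" "q \<in> {a..b}" for p q
  proof -
    obtain z where "p < z" "z < q" "g c q - g c p = (q - p) * deriv (g c) z"
      using MVT2[OF \<open>p < q\<close>, of "g c" "deriv (g c)"] g_DERIV by blast
    then show ?thesis
      using that by (intro bexI[of _ z]) (auto simp: power2_eq_square)
  qed
  consider "p < q" | "p = q" | "q < p" by linarith
  then show ?thesis
  proof cases
    case 1
    then obtain z where "z \<in> {a..b}" "(q - p) * (g c q - g c p) = deriv (g c) z * (q - p)\<^sup>2"
      using *[of p q] assms by blast
    then show ?thesis by (intro bexI[of _ z]) (auto simp: power2_commute algebra_simps)
  next
    case 2
    then show ?thesis using assms by auto
  next
    case 3
    then show ?thesis using *[of q p] assms by blast
  qed
qed

lemma uniform_negative_slope: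
  assumes "\<And>r. r \<in> {a..b} \<Longrightarrow> deriv (g c) r < 0"
  obtains \<gamma> where "0 < \<gamma>" "\<And>r. r \<in> {a..b} \<Longrightarrow> deriv (g c) r \<le> - \<gamma>"
proof (cases "a \<le> b")
  case True
  then obtain z where "z \<in> {a..b}" "\<forall>r\<in>{a..b}. deriv (g c) r \<le> deriv (g c) z"
    using continuous_attains_sup[OF compact_Icc _ continuous_on_deriv_g] by (metis atLeastatMost_empty_iff)
  then show ?thesis using assms[of z] that[of "- deriv (g c) z"] by simp
next
  case False
  then show ?thesis using that[of 1] by auto
qed

lemma uniform_positive_slope:
  assumes "\<And>r. r \<in> {a..b} \<Longrightarrow> 0 < deriv (g c) r"
  obtains \<gamma> where "0 < \<gamma>" "\<And>r. r \<in> {a..b} \<Longrightarrow> \<gamma> \<le> deriv (g c) r"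
proof (cases "a \<le> b")
  case True
  then obtain z where "z \<in> {a..b}" "\<forall>r\<in>{a..b}. deriv (g c) z \<le> deriv (g c) r"
    using continuous_attains_inf[OF compact_Icc _ continuous_on_deriv_g] by (metis atLeastatMost_empty_iff)
  then show ?thesis using assms[of z] that[of "deriv (g c) z"] by simp
next
  case False
  then show ?thesis using that[of 1] by auto
qed

lemma critical_points:
  assumes "4 < c"
  shows "0 < x1 c" "x1 c < x2 c" "(x1 c)\<^sup>2 + (x2 c)\<^sup>2 = 2 * (c - 1)" "(x1 c)\<^sup>2 * (x2 c)\<^sup>2 = 1 + 2 * c"
proof -
  define d where "d = sqrt (c * (c - 4))"
  have d: "0 < d" "d\<^sup>2 = c * (c - 4)" using assms by (auto simp: d_def)
  have "d < c - 1" by (rule power2_less_imp_less) (use assms d in \<open>auto simp: power2_eq_square algebra_simps\<close>)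
  then show "0 < x1 c" "x1 c < x2 c" using d by (auto simp: x1_def x2_def d_def[symmetric])
  have sq: "(x1 c)\<^sup>2 = c - 1 - d" "(x2 c)\<^sup>2 = c - 1 + d"
    using \<open>d < c - 1\<close> d by (auto simp: x1_def x2_def d_def[symmetric])
  show "(x1 c)\<^sup>2 + (x2 c)\<^sup>2 = 2 * (c - 1)" by (simp add: sq)
  have "(x1 c)\<^sup>2 * (x2 c)\<^sup>2 = (c - 1)\<^sup>2 - d\<^sup>2" unfolding sq by (simp add: power2_eq_square algebra_simps)
  then show "(x1 c)\<^sup>2 * (x2 c)\<^sup>2 = 1 + 2 * c" unfolding d by (simp add: power2_eq_square algebra_simps)
qed

text \<open>
  The numerator of the derivative is a quadratic polynomial in \<open>x\<^sup>2\<close> whose roots are \<open>(x1 c)\<^sup>2\<close> and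
  \<open>(x2 c)\<^sup>2\<close>, by Vieta's formulas. On the positive half-line \<open>g c\<close> thus decreases up to \<open>x1 c\<close>,
  increases up to \<open>x2 c\<close> and decreases afterwards.
\<close>

lemma deriv_g_factored:
  assumes "4 < c"
  shows "deriv (g c) x = - ((x\<^sup>2 - (x1 c)\<^sup>2) * (x\<^sup>2 - (x2 c)\<^sup>2)) / (1 + x\<^sup>2)\<^sup>2"
proof -
  have nz: "(1 + x\<^sup>2)\<^sup>2 \<noteq> 0" using one_plus_square_pos[of x] by simp
  have "(x\<^sup>2 - (x1 c)\<^sup>2) * (x\<^sup>2 - (x2 c)\<^sup>2)
      = x\<^sup>2 * x\<^sup>2 - ((x1 c)\<^sup>2 + (x2 c)\<^sup>2) * x\<^sup>2 + (x1 c)\<^sup>2 * (x2 c)\<^sup>2"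
    by (simp add: algebra_simps)
  also have "\<dots> = (1 + x\<^sup>2)\<^sup>2 + 2 * c * (1 - x\<^sup>2)"
    unfolding critical_points(3,4)[OF assms] by (simp add: power2_eq_square algebra_simps)
  finally show ?thesis using nz unfolding deriv_g by (simp add: field_simps)
qed

lemma deriv_g_sign:
  assumes "4 < c"
  shows "0 \<le> x \<Longrightarrow> x < x1 c \<Longrightarrow> deriv (g c) x < 0"
    and "x1 c < x \<Longrightarrow> x < x2 c \<Longrightarrow> 0 < deriv (g c) x"
    and "x2 c < x \<Longrightarrow> deriv (g c) x < 0"
proof -
  have pos: "0 < (1 + x\<^sup>2)\<^sup>2" using one_plus_square_pos[of x] by simp
  note cp = critical_points(1,2)[OF assms]
  have lt: "0 \<le> p \<Longrightarrow> p < q \<Longrightarrow> p\<^sup>2 < q\<^sup>2" for p q :: real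
    by (simp add: power_strict_mono)
  show "deriv (g c) x < 0" if "0 \<le> x" "x < x1 c"
  proof -
    have "x\<^sup>2 < (x1 c)\<^sup>2" "x\<^sup>2 < (x2 c)\<^sup>2" using lt that cp by auto
    then have "0 < (x\<^sup>2 - (x1 c)\<^sup>2) * (x\<^sup>2 - (x2 c)\<^sup>2)" by (intro mult_neg_neg) auto
    then show ?thesis unfolding deriv_g_factored[OF assms] using pos by (intro divide_neg_pos) auto
  qed
  show "0 < deriv (g c) x" if "x1 c < x" "x < x2 c"
  proof -
    have "(x1 c)\<^sup>2 < x\<^sup>2" "x\<^sup>2 < (x2 c)\<^sup>2" using lt that cp by auto
    then have "(x\<^sup>2 - (x1 c)\<^sup>2) * (x\<^sup>2 - (x2 c)\<^sup>2) < 0" by (intro mult_pos_neg) auto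
    then show ?thesis unfolding deriv_g_factored[OF assms] using pos by (intro divide_pos_pos) auto
  qed
  show "deriv (g c) x < 0" if "x2 c < x"
  proof -
    have "(x1 c)\<^sup>2 < x\<^sup>2" "(x2 c)\<^sup>2 < x\<^sup>2" using lt that cp by auto
    then have "0 < (x\<^sup>2 - (x1 c)\<^sup>2) * (x\<^sup>2 - (x2 c)\<^sup>2)" by (intro mult_pos_pos) auto
    then show ?thesis unfolding deriv_g_factored[OF assms] using pos by (intro divide_neg_pos) auto
  qed
qed

lemma lambda1_pos:
  assumes "4 < c"
  shows "0 < lambda1 c"
  using g_le_neg[of c "x2 c"] critical_points(1,2)[OF assms] assms by (simp add: lambda1_def)

lemma exp_decay_imp_zero:
  fixes d C \<gamma> :: real
  assumes "0 < \<gamma>" and le: "\<And>r. 0 \<le> r \<Longrightarrow> \<bar>d\<bar> * exp (\<gamma> * r) \<le> C"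
  shows "d = 0"
proof (rule ccontr)
  assume "d \<noteq> 0"
  then have d: "0 < \<bar>d\<bar>" by simp
  have "0 \<le> C" using le[of 0] d by simp
  define r where "r = C / \<bar>d\<bar> / \<gamma>"
  have "0 \<le> r" "\<gamma> * r = C / \<bar>d\<bar>" using \<open>0 \<le> C\<close> d \<open>0 < \<gamma>\<close> by (auto simp: r_def)
  then have "1 + C / \<bar>d\<bar> \<le> exp (\<gamma> * r)" using exp_ge_add_one_self[of "\<gamma> * r"] by simp
  then have "\<bar>d\<bar> * (1 + C / \<bar>d\<bar>) \<le> \<bar>d\<bar> * exp (\<gamma> * r)" using d by (intro mult_left_mono) auto
  then show False using le[OF \<open>0 \<le> r\<close>] d by (simp add: distrib_left)
qed

section \<open>Solutions of the forced equation\<close>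

locale forced_equation =
  fixes c :: real and y :: "real \<Rightarrow> real" and lam :: real
  assumes c_gt: "4 < c"
    and y_cont: "continuous_on UNIV y"
    and y_bounded: "bounded (range y)"
begin

abbreviation sol :: "(real \<Rightarrow> real) \<Rightarrow> bool" where
  "sol \<equiv> solution_on c y lam UNIV"

abbreviation forcing :: "real \<Rightarrow> real" where
  "forcing t \<equiv> lam + y t"

lemma sol_iff: "sol x \<longleftrightarrow> (\<forall>t. (x has_real_derivative forcing t + g c (x t)) (at t))"
  by (simp add: solution_on_def)

lemma sol_deriv: "sol x \<Longrightarrow> (x has_real_derivative forcing t + g c (x t)) (at t)"
  by (simp add: sol_iff)

lemma sol_continuous: "sol x \<Longrightarrow> continuous_on S x"
  by (intro continuous_at_imp_continuous_on ballI DERIV_isCont) (rule sol_deriv)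

lemma forcing_bounded: obtains B where "\<And>t. \<bar>forcing t\<bar> \<le> B"
proof -
  obtain B where "\<And>t. \<bar>y t\<bar> \<le> B" using y_bounded by (auto simp: bounded_iff)
  then show ?thesis 
    using that[of "\<bar>lam\<bar> + B"] order_trans[OF abs_triangle_ineq add_left_mono] by blast
qed

lemma sol_through: obtains x where "sol x" "x s = v"
proof -
  obtain B where B: "\<And>t. \<bar>forcing t\<bar> \<le> B" using forcing_bounded by blast
  have "0 < 1 + 2 * c" "0 \<le> c" using c_gt by auto
  moreover have "continuous_on UNIV forcing" by (intro continuous_intros y_cont)
  ultimately obtain x where "x s = v" "\<forall>t. (x has_real_derivative forcing t + g c (x t)) (at t)"
    using global_solution_exists[of "1 + 2 * c" forcing B "g c" s v] B g_lipschitz by metis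
  then show ?thesis using that[of x] by (simp add: sol_iff)
qed

lemma solution_order:
  assumes x: "solution_on c y lam I x" and z: "solution_on c y lam I z"
    and "s \<in> I" "t \<in> I" "x s \<le> z s"
  shows "x t \<le> z t"
proof -
  have sub: "r \<in> I" if "min s t \<le> r" "r \<le> max s t" for r
    using x that assms(3,4) mem_is_interval_1_I[of I "min s t" "max s t" r]
    by (auto simp: solution_on_def min_def max_def split: if_splits)
  have dx: "(x has_real_derivative lam + y r + g c (x r)) (at r)"
    and dz: "(z has_real_derivative lam + y r + g c (z r)) (at r)" if "r \<in> I" for r
    using x z that by (auto simp: solution_on_def)
  have lip: "\<bar>g c p - g c q\<bar> \<le> (1 + 2 * c) * \<bar>p - q\<bar>" for p q
    using g_lipschitz c_gt by simp
  show ?thesis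
  proof (cases "s \<le> t")
    case True
    have "0 \<le> z t - x t"
    proof (rule nonneg_invariant[OF True, where L = "1 + 2 * c"
          and h' = "\<lambda>r. g c (z r) - g c (x r)"])
      fix r assume "s \<le> r" "r \<le> t"
      then have r: "r \<in> I" using sub[of r] True by simp
      show "((\<lambda>r. z r - x r) has_real_derivative g c (z r) - g c (x r)) (at r)"
        using DERIV_diff[OF dz[OF r] dx[OF r]] by simp
      show "- (1 + 2 * c) * \<bar>z r - x r\<bar> \<le> g c (z r) - g c (x r)"
        using lip[of "z r" "x r"] by linarith
    qed (use assms in simp)
    then show ?thesis by simp
  next
    case False
    have "0 \<le> z (- (- t)) - x (- (- t))"
    proof (rule nonneg_invariant[of "- s" "- t" "\<lambda>r. z (- r) - x (- r)"
          "\<lambda>r. - (g c (z (- r)) - g c (x (- r)))" "1 + 2 * c"])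
      fix r assume "- s \<le> r" "r \<le> - t"
      then have r: "- r \<in> I" using sub[of "- r"] False by simp
      have "((\<lambda>r. z r - x r) has_real_derivative g c (z (- r)) - g c (x (- r))) (at (- r))"
        using DERIV_diff[OF dz[OF r] dx[OF r]] by simp
      then show "((\<lambda>r. z (- r) - x (- r)) has_real_derivative
          - (g c (z (- r)) - g c (x (- r)))) (at r)"
        using DERIV_mirror[of "\<lambda>r. z r - x r"] by blast
      show "- (1 + 2 * c) * \<bar>z (- r) - x (- r)\<bar> \<le> - (g c (z (- r)) - g c (x (- r)))"
        using lip[of "z (- r)" "x (- r)"] by linarith
    qed (use assms False in auto)
    then show ?thesis by simp
  qed
qed

lemma sol_order: "sol x \<Longrightarrow> sol z \<Longrightarrow> x s \<le> z s \<Longrightarrow> x t \<le> z t"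
  using solution_order[of UNIV] by blast

lemma sol_strict_order: "sol x \<Longrightarrow> sol z \<Longrightarrow> x s < z s \<Longrightarrow> x t < z t"
  using sol_order[of z x t s] by (meson not_le)

text \<open>
  Solutions exist globally and are unique on intervals, so the only maximal domain is \<open>\<real>\<close>.
\<close>

lemma maximal_solution_global:
  assumes "maximal_solution c y lam I x" "s \<in> I"
  shows "I = UNIV" "sol x"
proof -
  have x: "solution_on c y lam I x" using assms by (simp add: maximal_solution_def)
  obtain z where z: "sol z" "z s = x s" by (rule sol_through)
  then have "solution_on c y lam I z" using x by (auto simp: solution_on_def)
  then have "\<forall>t\<in>I. z t = x t"
    using solution_order[OF x _ assms(2)] solution_order[OF _ x assms(2)] z(2)
    by (metis order_antisym order_refl)
  then show "I = UNIV" using assms(1) z(1) unfolding maximal_solution_def by blast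
  then show "sol x" using x by simp
qed

lemma difference_deriv:
  assumes "sol x" "sol z"
  shows "((\<lambda>t. (x t - z t)\<^sup>2) has_real_derivative
    2 * ((x t - z t) * (g c (x t) - g c (z t)))) (at t)"
  using DERIV_power[OF DERIV_diff[OF sol_deriv[OF assms(1)] sol_deriv[OF assms(2)]], where n = 2, of t]
  by (simp add: algebra_simps)

text \<open>
  Working with the square of the difference avoids distinguishing which solution is the larger one:
  the forcing cancels, and the secant slope of \<open>g c\<close> controls the growth rate.
\<close>

lemma difference_contracts:
  assumes "sol x" "sol z" "s \<le> t"
    and "\<And>r. s \<le> r \<Longrightarrow> x r \<in> {a..b}" "\<And>r. s \<le> r \<Longrightarrow> z r \<in> {a..b}"
    and slope: "\<And>p. p \<in> {a..b} \<Longrightarrow> deriv (g c) p \<le> k"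
  shows "\<bar>x t - z t\<bar> \<le> \<bar>x s - z s\<bar> * exp (k * (t - s))"
proof (rule power2_le_imp_le)
  have "(x t - z t)\<^sup>2 \<le> (x s - z s)\<^sup>2 * exp (2 * k * (t - s))"
  proof (rule exp_growth_bound[OF \<open>s \<le> t\<close> difference_deriv[OF assms(1,2)]])
    fix r assume "s \<le> r"
    obtain p where "p \<in> {a..b}"
      "(x r - z r) * (g c (x r) - g c (z r)) = deriv (g c) p * (x r - z r)\<^sup>2"
      using secant_slope[OF assms(4,5)[OF \<open>s \<le> r\<close>]] by blast
    then show "2 * ((x r - z r) * (g c (x r) - g c (z r))) \<le> 2 * k * (x r - z r)\<^sup>2"
      using mult_right_mono[OF slope, of p "(x r - z r)\<^sup>2"] by simp
  qed
  then show "\<bar>x t - z t\<bar>\<^sup>2 \<le> (\<bar>x s - z s\<bar> * exp (k * (t - s)))\<^sup>2"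
    by (simp add: power_mult_distrib mult.assoc flip: exp_double)
qed simp

lemma difference_expands:
  assumes "sol x" "sol z" "s \<le> t"
    and "\<And>r. s \<le> r \<Longrightarrow> x r \<in> {a..b}" "\<And>r. s \<le> r \<Longrightarrow> z r \<in> {a..b}"
    and slope: "\<And>p. p \<in> {a..b} \<Longrightarrow> k \<le> deriv (g c) p"
  shows "\<bar>x s - z s\<bar> * exp (k * (t - s)) \<le> \<bar>x t - z t\<bar>"
proof (rule power2_le_imp_le)
  have "- (x t - z t)\<^sup>2 \<le> - (x s - z s)\<^sup>2 * exp (2 * k * (t - s))"
  proof (rule exp_growth_bound[OF \<open>s \<le> t\<close> DERIV_minus[OF difference_deriv[OF assms(1,2)]]])
    fix r assume "s \<le> r"
    obtain p where "p \<in> {a..b}"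
      "(x r - z r) * (g c (x r) - g c (z r)) = deriv (g c) p * (x r - z r)\<^sup>2"
      using secant_slope[OF assms(4,5)[OF \<open>s \<le> r\<close>]] by blast
    then show "- (2 * ((x r - z r) * (g c (x r) - g c (z r)))) \<le> 2 * k * - (x r - z r)\<^sup>2"
      using mult_right_mono[OF slope, of p "(x r - z r)\<^sup>2"] by simp
  qed
  then show "(\<bar>x s - z s\<bar> * exp (k * (t - s)))\<^sup>2 \<le> \<bar>x t - z t\<bar>\<^sup>2"
    by (simp add: power_mult_distrib mult.assoc flip: exp_double)
qed simp

lemma contracting_strip_attracts:
  assumes "sol x" "sol z"
    and strip: "\<And>r. s \<le> r \<Longrightarrow> x r \<in> {a..b}" "\<And>r. s \<le> r \<Longrightarrow> z r \<in> {a..b}"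
    and neg: "\<And>p. p \<in> {a..b} \<Longrightarrow> deriv (g c) p < 0"
  shows "((\<lambda>t. x t - z t) \<longlongrightarrow> 0) at_top"
proof -
  obtain \<gamma> where \<gamma>: "0 < \<gamma>" "\<And>p. p \<in> {a..b} \<Longrightarrow> deriv (g c) p \<le> - \<gamma>"
    using uniform_negative_slope[OF neg] by blast
  have "LIM t at_top. - \<gamma> * (t - s) :> at_bot"
    using \<gamma>(1) by (intro filterlim_tendsto_neg_mult_at_bot[OF tendsto_const]
        filterlim_tendsto_add_at_top[OF tendsto_const[of "- s"] filterlim_ident, simplified]) auto
  then have "((\<lambda>t. exp (- \<gamma> * (t - s))) \<longlongrightarrow> 0) at_top"
    by (rule filterlim_compose[OF exp_at_bot])
  then have lim: "((\<lambda>t. \<bar>x s - z s\<bar> * exp (- \<gamma> * (t - s))) \<longlongrightarrow> 0) at_top"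
    by (rule tendsto_mult_right_zero)
  show ?thesis
  proof (rule Lim_null_comparison[OF _ lim])
    show "\<forall>\<^sub>F t in at_top. norm (x t - z t) \<le> \<bar>x s - z s\<bar> * exp (- \<gamma> * (t - s))"
      using eventually_ge_at_top[of s]
      by eventually_elim (simp only: real_norm_def, rule difference_contracts[OF assms(1,2) _ strip \<gamma>(2)])
  qed
qed

text \<open>
  The difference is bounded in the past and contracts exponentially from there.
\<close>

lemma contracting_strip_unique:
  assumes "sol x" "sol z" and strip: "\<And>r. x r \<in> {a..b}" "\<And>r. z r \<in> {a..b}"
    and neg: "\<And>p. p \<in> {a..b} \<Longrightarrow> deriv (g c) p < 0"
  shows "x = z"
proof
  fix t
  obtain \<gamma> where \<gamma>: "0 < \<gamma>" "\<And>p. p \<in> {a..b} \<Longrightarrow> deriv (g c) p \<le> - \<gamma>"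
    using uniform_negative_slope[OF neg] by blast
  have "\<bar>x t - z t\<bar> * exp (\<gamma> * r) \<le> b - a" if "0 \<le> r" for r
  proof -
    have "\<bar>x t - z t\<bar> \<le> \<bar>x (t - r) - z (t - r)\<bar> * exp (- \<gamma> * (t - (t - r)))"
      by (rule difference_contracts[OF assms(1,2) _ strip \<gamma>(2)]) (use that in auto)
    also have "\<dots> \<le> (b - a) * exp (- \<gamma> * r)"
      using strip[of "t - r"] by (auto intro!: mult_right_mono simp: abs_le_iff)
    finally have "\<bar>x t - z t\<bar> * exp (\<gamma> * r) \<le> (b - a) * exp (- \<gamma> * r) * exp (\<gamma> * r)"
      by (intro mult_right_mono) auto
    then show ?thesis by (simp add: mult.assoc flip: exp_add)
  qed
  then show "x t = z t" using exp_decay_imp_zero[OF \<gamma>(1), of "x t - z t" "b - a"] by simp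
qed

text \<open>
  Two distinct solutions separate exponentially, hence cannot both remain in a bounded strip of
  positive slope in the future.
\<close>

lemma expanding_strip_unique:
  assumes "sol x" "sol z"
    and strip: "\<And>r. s \<le> r \<Longrightarrow> x r \<in> {a..b}" "\<And>r. s \<le> r \<Longrightarrow> z r \<in> {a..b}"
    and pos: "\<And>p. p \<in> {a..b} \<Longrightarrow> 0 < deriv (g c) p"
  shows "x s = z s"
proof -
  obtain \<gamma> where \<gamma>: "0 < \<gamma>" "\<And>p. p \<in> {a..b} \<Longrightarrow> \<gamma> \<le> deriv (g c) p"
    using uniform_positive_slope[OF pos] by blast
  have "\<bar>x s - z s\<bar> * exp (\<gamma> * r) \<le> b - a" if "0 \<le> r" for r
  proof -
    have "\<bar>x s - z s\<bar> * exp (\<gamma> * (s + r - s)) \<le> \<bar>x (s + r) - z (s + r)\<bar>"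
      by (rule difference_expands[OF assms(1,2) _ strip \<gamma>(2)]) (use that in auto)
    also have "\<dots> \<le> b - a"
      using strip[of "s + r"] that by (auto simp: abs_le_iff)
    finally show ?thesis by simp
  qed
  then show ?thesis using exp_decay_imp_zero[OF \<gamma>(1), of "x s - z s" "b - a"] by simp
qed

lemma slope_integral:
  assumes "sol b" "s \<le> t"
  shows "(\<And>r. deriv (g c) (b r) \<le> k) \<Longrightarrow>
      (LBINT r=ereal s..ereal t. deriv (g c) (b r)) \<le> k * (t - s)"
    and "(\<And>r. k \<le> deriv (g c) (b r)) \<Longrightarrow>
      k * (t - s) \<le> (LBINT r=ereal s..ereal t. deriv (g c) (b r))"
proof -
  have cont: "continuous_on {s..t} (\<lambda>r. deriv (g c) (b r))"
    by (intro continuous_on_compose2[OF continuous_on_deriv_g sol_continuous[OF assms(1)]]) auto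
  have eq: "(LBINT r=ereal s..ereal t. deriv (g c) (b r)) = integral {s..t} (\<lambda>r. deriv (g c) (b r))"
    by (intro interval_integral_eq_integral \<open>s \<le> t\<close> borel_integrable_atLeastAtMost' cont)
  have const: "integral {s..t} (\<lambda>r. k) = k * (t - s)" using \<open>s \<le> t\<close> by simp
  have int: "(\<lambda>r. deriv (g c) (b r)) integrable_on {s..t}"
    by (rule integrable_continuous_interval[OF cont])
  show "(LBINT r=ereal s..ereal t. deriv (g c) (b r)) \<le> k * (t - s)" if "\<And>r. deriv (g c) (b r) \<le> k"
    unfolding eq const[symmetric] by (intro integral_le int integrable_const_ivl that)
  show "k * (t - s) \<le> (LBINT r=ereal s..ereal t. deriv (g c) (b r))" if "\<And>r. k \<le> deriv (g c) (b r)"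
    unfolding eq const[symmetric] by (intro integral_le int integrable_const_ivl that)
qed

lemma sol_in_strip_bounded:
  assumes "sol x" "\<And>t. x t \<in> {a..b}"
  shows "bounded_solution c y lam x"
  using assms(1) bounded_subset[OF bounded_closed_interval[of a b], of "range x"] assms(2)
  by (auto simp: bounded_solution_def image_subset_iff simp del: atLeastAtMost_iff)

lemma contracting_strip_hyperbolic:
  assumes "sol b" and strip: "\<And>t. b t \<in> {p..q}"
    and neg: "\<And>r. r \<in> {p..q} \<Longrightarrow> deriv (g c) r < 0"
  shows "hyperbolic_attractive c y lam b"
proof -
  obtain \<gamma> where \<gamma>: "0 < \<gamma>" "\<And>r. r \<in> {p..q} \<Longrightarrow> deriv (g c) r \<le> - \<gamma>"
    using uniform_negative_slope[OF neg] by blast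
  have "exp (LBINT r=ereal s..ereal t. deriv (g c) (b r)) \<le> 1 * exp (- \<gamma> * (t - s))" if "s \<le> t" for s t
    using slope_integral(1)[OF assms(1) that \<gamma>(2)[OF strip]] by simp
  then show ?thesis
    unfolding hyperbolic_attractive_def using sol_in_strip_bounded[OF assms(1,2)] \<gamma>(1) by blast
qed

lemma expanding_strip_hyperbolic:
  assumes "sol b" and strip: "\<And>t. b t \<in> {p..q}"
    and pos: "\<And>r. r \<in> {p..q} \<Longrightarrow> 0 < deriv (g c) r"
  shows "hyperbolic_repulsive c y lam b"
proof -
  obtain \<gamma> where \<gamma>: "0 < \<gamma>" "\<And>r. r \<in> {p..q} \<Longrightarrow> \<gamma> \<le> deriv (g c) r"
    using uniform_positive_slope[OF pos] by blast
  have "exp (LBINT r=ereal s..ereal t. deriv (g c) (b r)) \<le> 1 * exp (\<gamma> * (t - s))" if "t \<le> s" for s t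
    using slope_integral(2)[OF assms(1) that \<gamma>(2)[OF strip]]
    by (simp add: interval_integral_endpoints_reverse[of "ereal s" "ereal t"] algebra_simps)
  then show ?thesis
    unfolding hyperbolic_repulsive_def using sol_in_strip_bounded[OF assms(1,2)] \<gamma>(1) by blast
qed

text \<open>
  Nonnegative slope along the whole past keeps the exponential at least 1 over arbitrarily long times,
  which is incompatible with decay.
\<close>

lemma not_attractive_of_past_expansion:
  assumes "sol b" and past: "\<And>r. r \<le> s \<Longrightarrow> 0 \<le> deriv (g c) (b r)"
  shows "\<not> hyperbolic_attractive c y lam b"
proof
  assume "hyperbolic_attractive c y lam b"
  then obtain k \<gamma> where k: "1 \<le> k" "0 < \<gamma>"
    and decay: "\<And>s t. s \<le> t \<Longrightarrow>
      exp (LBINT r=ereal s..ereal t. deriv (g c) (b r)) \<le> k * exp (- \<gamma> * (t - s))"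
    by (auto simp: hyperbolic_attractive_def)
  have "\<bar>1\<bar> * exp (\<gamma> * r) \<le> k" if "0 \<le> r" for r
  proof -
    have cont: "continuous_on {s - r..s} (\<lambda>r. deriv (g c) (b r))"
      by (intro continuous_on_compose2[OF continuous_on_deriv_g sol_continuous[OF assms(1)]]) auto
    have "(LBINT r=ereal (s - r)..ereal s. deriv (g c) (b r))
        = integral {s - r..s} (\<lambda>r. deriv (g c) (b r))"
      using that by (intro interval_integral_eq_integral borel_integrable_atLeastAtMost' cont) auto
    moreover have "0 \<le> integral {s - r..s} (\<lambda>r. deriv (g c) (b r))"
      by (intro integral_nonneg integrable_continuous_interval cont) (use past in auto)
    ultimately have "1 \<le> k * exp (- \<gamma> * r)"
      using decay[of "s - r" s] that order_trans[OF iffD2[OF one_le_exp_iff]] by simp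
    then have "1 * exp (\<gamma> * r) \<le> k * exp (- \<gamma> * r) * exp (\<gamma> * r)"
      by (intro mult_right_mono) auto
    then show ?thesis by (simp add: mult.assoc flip: exp_add)
  qed
  then show False using exp_decay_imp_zero[OF k(2), of 1 k] by simp
qed

section \<open>Crossing of constant levels\<close>

text \<open>
  The position of a solution relative to a constant level \<open>v\<close> is studied in four situations: above
  or below the level (\<open>\<sigma> = 1\<close> or \<open>-1\<close>), and in forward or backward time (\<open>\<tau> = 1\<close> or \<open>-1\<close>). In all
  of them \<open>\<sigma> * (x (\<tau> * r) - v)\<close> satisfies the same differential inequality, with the drift
  \<open>\<sigma> * \<tau> * (forcing t + g c v)\<close> across the level as driving term.
\<close>

lemma level_deriv:
  assumes "sol x"
  shows "((\<lambda>r. \<sigma> * (x (\<tau> * r) - v)) has_real_derivative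
    \<sigma> * \<tau> * (forcing (\<tau> * r) + g c (x (\<tau> * r)))) (at r)"
proof -
  have "((\<lambda>r. x (\<tau> * r)) has_real_derivative (forcing (\<tau> * r) + g c (x (\<tau> * r))) * (\<tau> * 1)) (at r)"
    by (rule DERIV_chain2[OF sol_deriv[OF assms] DERIV_cmult[OF DERIV_ident]])
  from DERIV_cmult[OF DERIV_diff[OF this DERIV_const], of \<sigma> v]
  show ?thesis by (simp add: mult_ac)
qed

lemma level_inequality:
  assumes "\<sigma> \<in> {1, -1}" "\<tau> \<in> {1, -1}"
  shows "\<sigma> * \<tau> * (forcing t + g c v) - (1 + 2 * c) * \<bar>\<sigma> * (p - v)\<bar>
    \<le> \<sigma> * \<tau> * (forcing t + g c p)"
proof -
  define K where "K = (1 + 2 * c) * \<bar>p - v\<bar>"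
  have "\<bar>g c v - g c p\<bar> \<le> K"
    using g_lipschitz[of c v p] c_gt by (simp add: abs_minus_commute K_def)
  moreover have eq: "\<bar>\<sigma> * (p - v)\<bar> = \<bar>p - v\<bar>" using assms by (auto simp: abs_mult)
  moreover have "\<sigma> * \<tau> = 1 \<or> \<sigma> * \<tau> = - 1" using assms by auto
  ultimately show ?thesis unfolding eq K_def[symmetric] by (elim disjE) (simp_all add: abs_le_iff)
qed

lemma level_invariant:
  assumes "\<sigma> \<in> {1, -1}" "\<tau> \<in> {1, -1}"
    and drift: "\<And>t. 0 \<le> \<sigma> * \<tau> * (forcing t + g c v)"
    and "sol x" "0 \<le> \<sigma> * (x s - v)" "0 \<le> \<tau> * (t - s)"
  shows "0 \<le> \<sigma> * (x t - v)"
proof -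
  have "\<tau> * s \<le> \<tau> * t" using assms(6) by (simp add: algebra_simps)
  moreover have "0 \<le> \<sigma> * (x (\<tau> * (\<tau> * s)) - v)" using assms(2,5) by auto
  ultimately have "0 \<le> \<sigma> * (x (\<tau> * (\<tau> * t)) - v)"
  proof (rule nonneg_invariant[OF _ _ level_deriv[OF \<open>sol x\<close>]])
    show "- (1 + 2 * c) * \<bar>\<sigma> * (x (\<tau> * r) - v)\<bar>
        \<le> \<sigma> * \<tau> * (forcing (\<tau> * r) + g c (x (\<tau> * r)))" for r
      using level_inequality[OF assms(1,2), of "\<tau> * r" v "x (\<tau> * r)"] drift[of "\<tau> * r"] by linarith
  qed
  then show ?thesis using assms(2) by auto
qed

lemma level_gain:
  assumes \<sigma>\<tau>: "\<sigma> \<in> {1, -1}" "\<tau> \<in> {1, -1}"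
    and rp: "recurrently_positive (\<lambda>t. \<sigma> * \<tau> * (forcing t + g c v))"
  shows "\<exists>W. \<exists>\<rho>>0. \<forall>x s t. sol x \<longrightarrow> 0 \<le> \<sigma> * (x s - v) \<longrightarrow> W \<le> \<tau> * (t - s) \<longrightarrow> \<rho> \<le> \<sigma> * (x t - v)"
proof -
  have rp': "recurrently_positive (\<lambda>t. \<sigma> * \<tau> * (forcing (\<tau> * t) + g c v))"
    using \<sigma>\<tau>(2) rp recurrently_positive_reflect[OF rp] by auto
  have "0 \<le> 1 + 2 * c" using c_gt by simp
  show ?thesis
  proof (rule recurrent_gain[OF rp' \<open>0 \<le> 1 + 2 * c\<close>])
    fix W \<rho> :: real
    assume "0 < \<rho>" and gain: "\<And>h h' s t. (\<And>r. (h has_real_derivative h' r) (at r)) \<Longrightarrow>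
       (\<And>r. \<sigma> * \<tau> * (forcing (\<tau> * r) + g c v) - (1 + 2 * c) * \<bar>h r\<bar> \<le> h' r) \<Longrightarrow>
       0 \<le> h s \<Longrightarrow> s + W \<le> t \<Longrightarrow> \<rho> \<le> h t"
    have "\<rho> \<le> \<sigma> * (x t - v)" if x: "sol x" "0 \<le> \<sigma> * (x s - v)" "W \<le> \<tau> * (t - s)" for x s t
    proof -
      have "0 \<le> \<sigma> * (x (\<tau> * (\<tau> * s)) - v)" "\<tau> * s + W \<le> \<tau> * t"
        using x \<sigma>\<tau>(2) by (auto simp: algebra_simps)
      from gain[OF level_deriv[OF x(1)] level_inequality[OF \<sigma>\<tau>] this]
      show ?thesis using \<sigma>\<tau>(2) by auto
    qed
    then show ?thesis using \<open>0 < \<rho>\<close> by blast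
  qed
qed

lemma confined_solution:
  assumes "a \<le> b"
    and "\<And>x s t. sol x \<Longrightarrow> x s \<in> {a..b} \<Longrightarrow> s \<le> t \<Longrightarrow> x t \<in> {a..b}"
  obtains u where "sol u" "\<And>t. u t \<in> {a..b}"
proof -
  have "\<exists>u\<in>{x. sol x}. \<forall>t. u t \<in> {a..b}"
  proof (rule ordered_family_confined[OF _ _ _ \<open>a \<le> b\<close>])
    show "\<exists>z\<in>{x. sol x}. z s = v" for s v using sol_through[of s v] by blast
    show "z t \<le> w t" if "z \<in> {x. sol x}" "w \<in> {x. sol x}" "z s \<le> w s" for z w s t
      using sol_order[of z w s t] that by blast
    show "z t \<in> {a..b}" if "z \<in> {x. sol x}" "z s \<in> {a..b}" "s \<le> t" for z s t
      using assms(2)[of z s t] that by blast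
  qed
  then obtain u where "sol u" "\<forall>t. u t \<in> {a..b}" by blast
  then show ?thesis using that[of u] by simp
qed

lemma confined_solution_backward:
  assumes "a \<le> b"
    and inv: "\<And>x s t. sol x \<Longrightarrow> x s \<in> {a..b} \<Longrightarrow> t \<le> s \<Longrightarrow> x t \<in> {a..b}"
  obtains u where "sol u" "\<And>t. u t \<in> {a..b}"
proof -
  let ?S = "(\<lambda>x t. x (- t)) ` {x. sol x}"
  have "\<exists>u\<in>?S. \<forall>t. u t \<in> {a..b}"
  proof (rule ordered_family_confined[OF _ _ _ \<open>a \<le> b\<close>])
    show "\<exists>z\<in>?S. z s = v" for s v
    proof -
      obtain x where "sol x" "x (- s) = v" by (rule sol_through)
      then show ?thesis by (intro bexI[of _ "\<lambda>t. x (- t)"] imageI) auto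
    qed
    show "z t \<le> w t" if zw: "z \<in> ?S" "w \<in> ?S" "z s \<le> w s" for z w s t
    proof -
      obtain z' w' where "z = (\<lambda>t. z' (- t))" "sol z'" "w = (\<lambda>t. w' (- t))" "sol w'"
        using zw(1,2) by blast
      then show ?thesis using sol_order[of z' w' "- s" "- t"] zw(3) by simp
    qed
    show "z t \<in> {a..b}" if z: "z \<in> ?S" "z s \<in> {a..b}" "s \<le> t" for z s t
    proof -
      obtain z' where "z = (\<lambda>t. z' (- t))" "sol z'" using z(1) by blast
      then show ?thesis using inv[of z' "- s" "- t"] z(2,3) by simp
    qed
  qed
  then obtain x where "sol x" "\<forall>t. x (- t) \<in> {a..b}" by auto
  then show ?thesis using that[of x] minus_minus by metis
qed

section \<open>Attractors, repeller and bistability\<close>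

lemma upper_barrier:
  obtains M where "x2 c \<le> M" "\<And>p t. M \<le> p \<Longrightarrow> forcing t + g c p \<le> 0"
proof -
  obtain B where B: "\<And>t. \<bar>forcing t\<bar> \<le> B" using forcing_bounded by blast
  have "0 < x2 c" using critical_points[OF c_gt] by simp
  have "forcing t + g c p \<le> 0" if "max B (x2 c) \<le> p" for p t
    using g_le_neg[of c p] B[of t] that c_gt \<open>0 < x2 c\<close> by auto
  then show ?thesis using that[of "max B (x2 c)"] by simp
qed

text \<open>
  The hypothesis says that the drift across the level \<open>x2 c\<close> points upwards, recurrently with a
  definite strength. Entire solutions above \<open>x2 c\<close> are thus uniformly above it, inside a strip where
  \<open>g c\<close> has negative slope.
\<close>

lemma upper_attractor:
  assumes rp: "recurrently_positive (\<lambda>t. forcing t - lambda1 c)"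
  obtains u \<rho> where "sol u" "bounded (range u)" "0 < \<rho>" "\<And>t. x2 c + \<rho> \<le> u t"
    "hyperbolic_attractive c y lam u"
    "\<And>v. sol v \<Longrightarrow> bounded (range v) \<Longrightarrow> (\<And>t. x2 c \<le> v t) \<Longrightarrow> v = u"
    "\<And>x s. sol x \<Longrightarrow> x2 c \<le> x s \<Longrightarrow> ((\<lambda>t. u t - x t) \<longlongrightarrow> 0) at_top"
proof -
  obtain M where M: "x2 c \<le> M" "\<And>p t. M \<le> p \<Longrightarrow> forcing t + g c p \<le> 0"
    using upper_barrier by blast
  have rp': "recurrently_positive (\<lambda>t. 1 * 1 * (forcing t + g c (x2 c)))"
    using rp by (simp add: lambda1_def)
  have drift: "0 \<le> 1 * 1 * (forcing t + g c (x2 c))" for t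
    by (rule recurrently_positiveD[OF rp'])
  have above: "x2 c \<le> x t" if "sol x" "x2 c \<le> x s" "s \<le> t" for x s t
    using level_invariant[of 1 1 "x2 c" x s t] drift that by simp
  have below: "x t \<le> p" if "sol x" "x s \<le> p" "s \<le> t" "M \<le> p" for x s t p
  proof -
    have "0 \<le> - 1 * 1 * (forcing r + g c p)" for r using M(2)[OF that(4), of r] by simp
    from level_invariant[OF _ _ this that(1), of s t] show ?thesis using that by simp
  qed
  obtain W \<rho> where "0 < \<rho>" and "\<forall>x s t. sol x \<longrightarrow> 0 \<le> 1 * (x s - x2 c) \<longrightarrow> W \<le> 1 * (t - s) \<longrightarrow>
      \<rho> \<le> 1 * (x t - x2 c)"
    using level_gain[OF _ _ rp'] by auto
  then have gain: "x2 c + \<rho> \<le> x t" if "sol x" "x2 c \<le> x s" "s + W \<le> t" for x s t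
    using that by (simp add: algebra_simps)
  have inv: "x t \<in> {x2 c..M}" if "sol x" "x s \<in> {x2 c..M}" "s \<le> t" for x s t
    using above[of x s t] below[of x s M t] that by auto
  obtain u where u: "sol u" "\<And>t. u t \<in> {x2 c..M}"
    using confined_solution[of "x2 c" M] M(1) inv by metis
  have u_gain: "x2 c + \<rho> \<le> u t" for t
    using gain[OF u(1), of "t - W" t] u(2)[of "t - W"] by simp
  have neg: "deriv (g c) p < 0" if "p \<in> {x2 c + \<rho>..b}" for p b
    using deriv_g_sign(3)[OF c_gt, of p] that \<open>0 < \<rho>\<close> by simp
  show ?thesis
  proof (rule that[OF u(1) _ \<open>0 < \<rho>\<close> u_gain])
    show "bounded (range u)"
      using sol_in_strip_bounded[OF u] by (simp add: bounded_solution_def)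
    show "hyperbolic_attractive c y lam u"
    proof (rule contracting_strip_hyperbolic[OF u(1) _ neg])
      show "u t \<in> {x2 c + \<rho>..M}" for t using u_gain[of t] u(2)[of t] by simp
    qed
    show "v = u" if v: "sol v" "bounded (range v)" "\<And>t. x2 c \<le> v t" for v
    proof -
      obtain B where B: "\<And>t. \<bar>v t\<bar> \<le> B" using v(2) by (auto simp: bounded_iff)
      have v_gain: "x2 c + \<rho> \<le> v t" for t using gain[OF v(1), of "t - W" t] v(3) by simp
      show ?thesis
      proof (rule contracting_strip_unique[OF v(1) u(1) _ _ neg])
        show "v t \<in> {x2 c + \<rho>..max M B}" "u t \<in> {x2 c + \<rho>..max M B}" for t
          using v_gain[of t] u_gain[of t] u(2)[of t] B[of t] by auto
      qed
    qed
    show "((\<lambda>t. u t - x t) \<longlongrightarrow> 0) at_top" if x: "sol x" "x2 c \<le> x s" for x s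
    proof (rule contracting_strip_attracts[OF u(1) x(1) _ _ neg[where b = "max M (x s)"], where s = "s + max W 0"])
      fix r assume "s + max W 0 \<le> r"
      then show "x r \<in> {x2 c + \<rho>..max M (x s)}" "u r \<in> {x2 c + \<rho>..max M (x s)}"
        using gain[OF x] below[OF x(1), of s "max M (x s)" r] u_gain[of r] u(2)[of r]
        by (auto simp: le_max_iff_disj)
    qed
  qed
qed

lemma nonneg_forward:
  assumes "\<And>t. 0 \<le> forcing t" "sol x" "0 \<le> x s" "s \<le> t"
  shows "0 \<le> x t"
  using level_invariant[of 1 1 0 x s t] assms by (simp add: g_zero)

text \<open>
  As for the upper attractor, with the drift pointing downwards at the level \<open>x1 c\<close> and the level 0
  closing the strip from below.
\<close>

lemma lower_attractor:
  assumes nonneg: "\<And>t. 0 \<le> forcing t"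
    and rp: "recurrently_positive (\<lambda>t. lambda2 c - forcing t)"
  obtains l \<rho> where "sol l" "0 < \<rho>" "\<And>t. 0 \<le> l t" "\<And>t. l t \<le> x1 c - \<rho>"
    "hyperbolic_attractive c y lam l"
    "\<And>v. sol v \<Longrightarrow> (\<And>t. 0 \<le> v t) \<Longrightarrow> (\<And>t. v t \<le> x1 c) \<Longrightarrow> v = l"
    "\<And>x s. sol x \<Longrightarrow> 0 \<le> x s \<Longrightarrow> x s \<le> x1 c \<Longrightarrow> ((\<lambda>t. l t - x t) \<longlongrightarrow> 0) at_top"
proof -
  have "(\<lambda>t. lambda2 c - forcing t) = (\<lambda>t. - 1 * 1 * (forcing t + g c (x1 c)))"
    by (auto simp: lambda2_def)
  then have rp': "recurrently_positive (\<lambda>t. - 1 * 1 * (forcing t + g c (x1 c)))"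
    using rp by (simp only:)
  have drift: "0 \<le> - 1 * 1 * (forcing t + g c (x1 c))" for t
    by (rule recurrently_positiveD[OF rp'])
  have below: "x t \<le> x1 c" if "sol x" "x s \<le> x1 c" "s \<le> t" for x s t
    using level_invariant[of "- 1" 1 "x1 c" x s t] drift that by simp
  obtain W \<rho> where "0 < \<rho>" and "\<forall>x s t. sol x \<longrightarrow> 0 \<le> - 1 * (x s - x1 c) \<longrightarrow> W \<le> 1 * (t - s) \<longrightarrow>
      \<rho> \<le> - 1 * (x t - x1 c)"
    using level_gain[OF _ _ rp'] by auto
  then have gain: "x t \<le> x1 c - \<rho>" if "sol x" "x s \<le> x1 c" "s + W \<le> t" for x s t
    using that by (force simp: algebra_simps)
  have inv: "x t \<in> {0..x1 c}" if "sol x" "x s \<in> {0..x1 c}" "s \<le> t" for x s t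
    using nonneg_forward[OF nonneg, of x s t] below[of x s t] that by auto
  have "0 \<le> x1 c" using critical_points(1)[OF c_gt] by simp
  then obtain l where l: "sol l" "\<And>t. l t \<in> {0..x1 c}"
    using confined_solution[of 0 "x1 c"] inv by metis
  have gain_entire: "v t \<le> x1 c - \<rho>" if "sol v" "\<And>t. v t \<le> x1 c" for v t
    using gain[OF that(1), of "t - W" t] that(2)[of "t - W"] by simp
  have l_gain: "l t \<le> x1 c - \<rho>" for t using gain_entire[OF l(1)] l(2) by simp
  have neg: "deriv (g c) p < 0" if "p \<in> {0..x1 c - \<rho>}" for p
    using deriv_g_sign(1)[OF c_gt, of p] that \<open>0 < \<rho>\<close> by simp
  show ?thesis
  proof (rule that[OF l(1) \<open>0 < \<rho>\<close> _ l_gain])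
    show "0 \<le> l t" for t using l(2)[of t] by simp
    show "hyperbolic_attractive c y lam l"
      using l_gain l(2) by (intro contracting_strip_hyperbolic[OF l(1) _ neg]) auto
    show "v = l" if v: "sol v" "\<And>t. 0 \<le> v t" "\<And>t. v t \<le> x1 c" for v
      using l(2) l_gain v(2) gain_entire[OF v(1,3)]
      by (intro contracting_strip_unique[OF v(1) l(1) _ _ neg]) auto
    show "((\<lambda>t. l t - x t) \<longlongrightarrow> 0) at_top" if x: "sol x" "0 \<le> x s" "x s \<le> x1 c" for x s
    proof (rule contracting_strip_attracts[OF l(1) x(1) _ _ neg, where s = "s + max W 0"])
      fix r assume "s + max W 0 \<le> r"
      then show "x r \<in> {0..x1 c - \<rho>}" "l r \<in> {0..x1 c - \<rho>}"
        using gain[OF x(1,3)] nonneg_forward[OF nonneg x(1,2), of r] l_gain[of r] l(2)[of r] by auto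
    qed
  qed
qed

text \<open>
  Under both drift conditions the strip between \<open>x1 c\<close> and \<open>x2 c\<close> is invariant in backward time and
  contains an entire solution \<open>m\<close>, uniformly inside. A solution that stays in the strip for all
  future times stays uniformly inside as well, where the slope of \<open>g c\<close> is positive, and so equals
  \<open>m\<close>. Hence every solution above \<open>m\<close> reaches \<open>[x2 c, \<infinity>)\<close>, every one below it reaches \<open>x1 c\<close> or lower values.
\<close>

lemma middle_repeller:
  assumes rp1: "recurrently_positive (\<lambda>t. forcing t - lambda1 c)"
    and rp2: "recurrently_positive (\<lambda>t. lambda2 c - forcing t)"
  obtains m where "\<And>t. x1 c < m t" "\<And>t. m t < x2 c" "hyperbolic_repulsive c y lam m"
    "\<And>x s. sol x \<Longrightarrow> m s < x s \<Longrightarrow> \<exists>t\<ge>s. x2 c \<le> x t"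
    "\<And>x s. sol x \<Longrightarrow> x s < m s \<Longrightarrow> \<exists>t\<ge>s. x t \<le> x1 c"
proof -
  have rp1': "recurrently_positive (\<lambda>t. - 1 * - 1 * (forcing t + g c (x2 c)))"
    using rp1 by (simp add: lambda1_def)
  have "(\<lambda>t. lambda2 c - forcing t) = (\<lambda>t. 1 * - 1 * (forcing t + g c (x1 c)))"
    by (auto simp: lambda2_def)
  then have rp2': "recurrently_positive (\<lambda>t. 1 * - 1 * (forcing t + g c (x1 c)))"
    using rp2 by (simp only:)
  have drift1: "0 \<le> - 1 * - 1 * (forcing t + g c (x2 c))" for t
    by (rule recurrently_positiveD[OF rp1'])
  have drift2: "0 \<le> 1 * - 1 * (forcing t + g c (x1 c))" for t
    by (rule recurrently_positiveD[OF rp2'])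
  obtain W2 \<rho>2 where "0 < \<rho>2" and "\<forall>x s t. sol x \<longrightarrow> 0 \<le> - 1 * (x s - x2 c) \<longrightarrow>
      W2 \<le> - 1 * (t - s) \<longrightarrow> \<rho>2 \<le> - 1 * (x t - x2 c)"
    using level_gain[OF _ _ rp1'] by auto
  then have gain2: "x t \<le> x2 c - \<rho>2" if "sol x" "x s \<le> x2 c" "t \<le> s - W2" for x s t
    using that by (force simp: algebra_simps)
  obtain W1 \<rho>1 where "0 < \<rho>1" and "\<forall>x s t. sol x \<longrightarrow> 0 \<le> 1 * (x s - x1 c) \<longrightarrow>
      W1 \<le> - 1 * (t - s) \<longrightarrow> \<rho>1 \<le> 1 * (x t - x1 c)"
    using level_gain[OF _ _ rp2'] by auto
  then have gain1: "x1 c + \<rho>1 \<le> x t" if "sol x" "x1 c \<le> x s" "t \<le> s - W1" for x s t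
    using that by (force simp: algebra_simps)
  have inv: "x t \<in> {x1 c..x2 c}" if "sol x" "x s \<in> {x1 c..x2 c}" "t \<le> s" for x s t
    using level_invariant[of 1 "- 1" "x1 c" x s t] level_invariant[of "- 1" "- 1" "x2 c" x s t]
      drift1 drift2 that by simp
  have "x1 c \<le> x2 c" using critical_points(2)[OF c_gt] by simp
  then obtain m where m: "sol m" "\<And>t. m t \<in> {x1 c..x2 c}"
    using confined_solution_backward[of "x1 c" "x2 c"] inv by metis
  define \<rho> W where "\<rho> = min \<rho>1 \<rho>2" and "W = max 0 (max W1 W2)"
  have "0 < \<rho>" using \<open>0 < \<rho>1\<close> \<open>0 < \<rho>2\<close> by (simp add: \<rho>_def)
  have "0 \<le> W" by (simp add: W_def)
  have ahead: "x t \<in> {x1 c + \<rho>..x2 c - \<rho>}" if "sol x" "x1 c \<le> x (t + W)" "x (t + W) \<le> x2 c" for x t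
    proof -
    have "t \<le> t + W - W1" "t \<le> t + W - W2" by (auto simp: W_def)
    from gain1[OF that(1,2) this(1)] gain2[OF that(1,3) this(2)]
    show ?thesis by (auto simp: \<rho>_def)
  qed
  have m_strip: "m t \<in> {x1 c + \<rho>..x2 c - \<rho>}" for t using ahead[OF m(1), of t] m(2)[of "t + W"] by simp
  have pos: "0 < deriv (g c) p" if "p \<in> {x1 c + \<rho>..x2 c - \<rho>}" for p
    using deriv_g_sign(2)[OF c_gt, of p] that \<open>0 < \<rho>\<close> by simp
  have stuck: "x s = m s" if "sol x" "\<And>t. s \<le> t \<Longrightarrow> x1 c \<le> x t" "\<And>t. s \<le> t \<Longrightarrow> x t \<le> x2 c" for x s
  proof (rule expanding_strip_unique[OF that(1) m(1) _ m_strip pos])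
    show "x r \<in> {x1 c + \<rho>..x2 c - \<rho>}" if "s \<le> r" for r
      using ahead[OF \<open>sol x\<close>, of r] \<open>0 \<le> W\<close> that \<open>\<And>t. s \<le> t \<Longrightarrow> x1 c \<le> x t\<close>
        \<open>\<And>t. s \<le> t \<Longrightarrow> x t \<le> x2 c\<close> by simp
  qed
  show ?thesis
  proof (rule that[of m])
    show "x1 c < m t" "m t < x2 c" for t using m_strip[of t] \<open>0 < \<rho>\<close> by auto
    show "hyperbolic_repulsive c y lam m" by (rule expanding_strip_hyperbolic[OF m(1) m_strip pos])
    show "\<exists>t\<ge>s. x2 c \<le> x t" if x: "sol x" "m s < x s" for x s
    proof (rule ccontr)
      assume "\<not> ?thesis"
      then have "x t < x2 c" if "s \<le> t" for t using that by (meson not_le)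
      moreover have "x1 c \<le> x t" for t
        using sol_strict_order[OF m(1) x, of t] m(2)[of t] by simp
      ultimately show False using stuck[OF x(1), of s] x(2) by (metis less_imp_le less_irrefl)
    qed
    show "\<exists>t\<ge>s. x t \<le> x1 c" if x: "sol x" "x s < m s" for x s
    proof (rule ccontr)
      assume "\<not> ?thesis"
      then have "x1 c < x t" if "s \<le> t" for t using that by (meson not_le)
      moreover have "x t \<le> x2 c" for t
        using sol_strict_order[OF x(1) m(1) x(2), of t] m(2)[of t] by simp
      ultimately show False using stuck[OF x(1), of s] x(2) by (metis less_imp_le less_irrefl)
    qed
  qed
qed

text \<open>
  Followed backwards from a negative value, a solution stays below 0, where \<open>g c\<close> is nonnegative, so
  it decreases at least at rate \<open>\<mu>\<close> and becomes unbounded.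
\<close>

lemma bounded_solution_nonneg:
  assumes "0 < \<mu>" "\<And>t. \<mu> \<le> forcing t" and b: "sol b" "bounded (range b)"
  shows "0 \<le> b t"
proof (rule ccontr)
  assume "\<not> 0 \<le> b t"
  then have neg: "b t < 0" by simp
  have forcing: "0 \<le> forcing r" for r using assms(1) assms(2)[of r] by linarith
  have past: "b r \<le> 0" if "r \<le> t" for r
    using nonneg_forward[OF forcing b(1), of r t] that neg by (meson not_le less_imp_le)
  obtain B where B: "\<And>r. \<bar>b r\<bar> \<le> B" using b(2) by (auto simp: bounded_iff)
  have "0 \<le> B" using B[of t] by linarith
  \<comment> \<open>Far enough in the past for a decrease by \<open>B\<close>.\<close>
  define s where "s = t - B / \<mu>"
  have "s \<le> t" using \<open>0 \<le> B\<close> assms(1) by (simp add: s_def)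
  have "b s - \<mu> * s \<le> b t - \<mu> * t"
  proof (rule DERIV_nonneg_imp_nondecreasing[OF \<open>s \<le> t\<close>])
    fix r assume "s \<le> r" "r \<le> t"
    have "((\<lambda>r. b r - \<mu> * r) has_real_derivative forcing r + g c (b r) - \<mu> * 1) (at r)"
      by (intro DERIV_diff sol_deriv b DERIV_cmult DERIV_ident)
    moreover have "0 \<le> forcing r + g c (b r) - \<mu> * 1"
      using assms(2)[of r] g_nonneg_left[OF _ past[OF \<open>r \<le> t\<close>], of c] c_gt by simp
    ultimately show "\<exists>z. ((\<lambda>r. b r - \<mu> * r) has_real_derivative z) (at r) \<and> 0 \<le> z" by blast
  qed
  then have "b s \<le> b t - B" using assms(1) by (simp add: s_def algebra_simps)
  then show False using neg B[of s] by linarith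
qed

lemma attracted_to_iff:
  assumes "maximal_solution c y lam I x" "s \<in> I"
  shows "attracted_to I x b \<longleftrightarrow> ((\<lambda>t. b t - x t) \<longlongrightarrow> 0) at_top"
  using maximal_solution_global(1)[OF assms] by (simp add: attracted_to_def)

text \<open>
  That there is no third attractive solution \<open>b\<close>: if \<open>b\<close> is neither \<open>l\<close> nor \<open>u\<close>, uniqueness of these
  in their regions makes \<open>b\<close> take a value below \<open>x2 c\<close> and a value above \<open>x1 c\<close>. Both properties
  persist in backward time, so in its remote past \<open>b\<close> lies where \<open>g c\<close> has positive slope.
\<close>

lemma bistable:
  assumes rp1: "recurrently_positive (\<lambda>t. forcing t - lambda1 c)"
    and rp2: "recurrently_positive (\<lambda>t. lambda2 c - forcing t)"
  shows "bistability c y lam"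
    and "\<exists>l m u. positive_bounded_below_x1 c y lam l \<and> positive_bounded_above_x2 c y lam u \<and>
      attractors_separated_by c y lam l m u"
proof -
  have forcing: "lambda1 c \<le> forcing t" for t using recurrently_positiveD[OF rp1, of t] by simp
  have nonneg: "0 \<le> forcing t" for t using forcing[of t] lambda1_pos[OF c_gt] by simp
  obtain u \<rho> where u: "sol u" "bounded (range u)" "0 < \<rho>" "\<And>t. x2 c + \<rho> \<le> u t"
    "hyperbolic_attractive c y lam u"
    "\<And>v. sol v \<Longrightarrow> bounded (range v) \<Longrightarrow> (\<And>t. x2 c \<le> v t) \<Longrightarrow> v = u"
    "\<And>x s. sol x \<Longrightarrow> x2 c \<le> x s \<Longrightarrow> ((\<lambda>t. u t - x t) \<longlongrightarrow> 0) at_top"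
    by (rule upper_attractor[OF rp1]) blast
  obtain l \<rho>' where l: "sol l" "0 < \<rho>'" "\<And>t. 0 \<le> l t" "\<And>t. l t \<le> x1 c - \<rho>'"
    "hyperbolic_attractive c y lam l"
    "\<And>v. sol v \<Longrightarrow> (\<And>t. 0 \<le> v t) \<Longrightarrow> (\<And>t. v t \<le> x1 c) \<Longrightarrow> v = l"
    "\<And>x s. sol x \<Longrightarrow> 0 \<le> x s \<Longrightarrow> x s \<le> x1 c \<Longrightarrow> ((\<lambda>t. l t - x t) \<longlongrightarrow> 0) at_top"
    by (rule lower_attractor[OF nonneg rp2]) blast
  obtain m where m: "\<And>t. x1 c < m t" "\<And>t. m t < x2 c" "hyperbolic_repulsive c y lam m"
    "\<And>x s. sol x \<Longrightarrow> m s < x s \<Longrightarrow> \<exists>t\<ge>s. x2 c \<le> x t"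
    "\<And>x s. sol x \<Longrightarrow> x s < m s \<Longrightarrow> \<exists>t\<ge>s. x t \<le> x1 c"
    by (rule middle_repeller[OF rp1 rp2]) blast
  have sol_m: "sol m" using m(3) by (simp add: hyperbolic_repulsive_def bounded_solution_def)
  note cp = critical_points(1,2)[OF c_gt]
  have lt: "l t < x1 c" for t using l(2) l(4)[of t] by linarith
  have gt: "x2 c < u t" for t using u(3) u(4)[of t] by linarith
  have pos_u: "0 \<le> u t" for t using gt[of t] cp by linarith
  have l_below: "positive_bounded_below_x1 c y lam l"
    using l(3,5) lt by (simp add: positive_bounded_below_x1_def positive_def hyperbolic_attractive_def)
  have u_above: "positive_bounded_above_x2 c y lam u"
    using pos_u u(5) gt by (simp add: positive_bounded_above_x2_def positive_def hyperbolic_attractive_def)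
  have basins: "basins_separated c y lam l m u"
    unfolding basins_separated_def
  proof (intro allI impI conjI; elim bexE conjE)
    fix I x s assume x: "maximal_solution c y lam I x" "s \<in> I" and "m s < x s"
    note sol_x = maximal_solution_global(2)[OF x]
    obtain t where "x2 c \<le> x t" using m(4)[OF sol_x \<open>m s < x s\<close>] by blast
    then show "attracted_to I x u" using attracted_to_iff[OF x] u(7)[OF sol_x] by simp
  next
    fix I x s assume x: "maximal_solution c y lam I x" "s \<in> I" and "x s < m s" "0 \<le> x s"
    note sol_x = maximal_solution_global(2)[OF x]
    obtain t where "s \<le> t" "x t \<le> x1 c" using m(5)[OF sol_x \<open>x s < m s\<close>] by blast
    moreover have "0 \<le> x t" by (rule nonneg_forward[OF nonneg sol_x \<open>0 \<le> x s\<close> \<open>s \<le> t\<close>])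
    ultimately show "attracted_to I x l" using attracted_to_iff[OF x] l(7)[OF sol_x] by simp
  qed
  have "attractors_separated_by c y lam l m u"
    unfolding attractors_separated_by_def
    using l(5) u(5) m(1-3) basins less_trans[OF lt m(1)] less_trans[OF m(2) gt] by simp
  then show "\<exists>l m u. positive_bounded_below_x1 c y lam l \<and> positive_bounded_above_x2 c y lam u \<and>
      attractors_separated_by c y lam l m u"
    using l_below u_above by blast

  have only: "b = l \<or> b = u" if hyp: "hyperbolic_attractive c y lam b" for b
  proof (rule ccontr)
    assume neq: "\<not> (b = l \<or> b = u)"
    have b: "sol b" "bounded (range b)"
      using hyp by (auto simp: hyperbolic_attractive_def bounded_solution_def)
    have b_nonneg: "0 \<le> b t" for t
      by (rule bounded_solution_nonneg[OF lambda1_pos[OF c_gt] forcing b])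
    obtain s where s: "b s < x2 c" using u(6)[OF b] neq by (meson not_le)
    obtain s' where s': "x1 c < b s'" using l(6)[OF b(1) b_nonneg] neq by (meson not_le)
    have past2: "b r < x2 c" if "r \<le> s" for r
    proof -
      have "0 \<le> 1 * 1 * (forcing t + g c (x2 c))" for t
        using forcing[of t] by (simp add: lambda1_def)
      from level_invariant[OF _ _ this b(1), of r s] show ?thesis using s that by fastforce
    qed
    have past1: "x1 c < b r" if "r \<le> s'" for r
    proof -
      have "0 \<le> - 1 * 1 * (forcing t + g c (x1 c))" for t
        using recurrently_positiveD[OF rp2, of t] by (simp add: lambda2_def)
      from level_invariant[OF _ _ this b(1), of r s'] show ?thesis using s' that by fastforce
    qed
    have "0 \<le> deriv (g c) (b r)" if "r \<le> min s s'" for r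
      using deriv_g_sign(2)[OF c_gt past1 past2, of r] that by simp
    then show False using not_attractive_of_past_expansion[OF b(1)] hyp by blast
  qed
  have "x2 c - x1 c \<le> \<bar>l t - u t\<bar>" for t using lt[of t] gt[of t] by linarith
  then have "x2 c - x1 c \<le> (INF t. \<bar>l t - u t\<bar>)" by (intro cINF_greatest) auto
  then have "uniformly_separated l u" using cp(2) by (simp add: uniformly_separated_def)
  moreover have "l \<noteq> u" using lt[of 0] gt[of 0] cp(2) by fastforce
  moreover have "{b. hyperbolic_attractive c y lam b} = {l, u}" using only l(5) u(5) by blast
  ultimately show "bistability c y lam"
    unfolding bistability_def using l(3) pos_u by (auto simp: positive_def)
qed

end

section \<open>The dynamics on the positive half-plane\<close>

theorem mainTheorem2:
  fixes y :: "real \<Rightarrow> real" and c :: real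
  assumes "bounded (range y)" and "uniformly_continuous_on UNIV y" and "c > 4"
  shows
    "(\<forall>lam. lam > lambda1 c - (INF r. y r) \<longrightarrow>
        (\<exists>u. positive_bounded_above_x2 c y lam u \<and>
           (\<forall>v. positive_bounded_above_x2 c y lam v \<longrightarrow> v = u) \<and>
           hyperbolic_attractive c y lam u \<and>
           (\<forall>I x. maximal_solution c y lam I x \<and> (\<exists>s\<in>I. x s \<in> {x2 c..})
              \<longrightarrow> attracted_to I x u)))
     \<and>
     (\<forall>lam \<in> {- (INF r. y r) ..< lambda2 c - (SUP r. y r)}.
        (\<exists>l. positive_bounded_below_x1 c y lam l \<and>
           (\<forall>v. positive_bounded_below_x1 c y lam v \<longrightarrow> v = l) \<and>
           hyperbolic_attractive c y lam l \<and>
           (lam > - (INF r. y r) \<longrightarrow> strictly_positive l) \<and>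
           (\<forall>I x. maximal_solution c y lam I x \<and> (\<exists>s\<in>I. x s \<in> {0..x1 c})
              \<longrightarrow> attracted_to I x l)))
     \<and>
     ((SUP r. y r) - (INF r. y r) < h1 c \<longrightarrow>
        (\<forall>lam \<in> {lambda1 c - (INF r. y r) <..< lambda2 c - (SUP r. y r)}.
           bistability c y lam \<and>
           (\<exists>l m u. positive_bounded_below_x1 c y lam l \<and>
              positive_bounded_above_x2 c y lam u \<and>
              attractors_separated_by c y lam l m u)))
     \<and>
     ((SUP r. y r) - (INF r. y r) \<le> h1 c \<and>
      (\<lambda>t. INF r. y r) \<notin> hull_of y \<and> (\<lambda>t. SUP r. y r) \<notin> hull_of y \<longrightarrow>
        (\<forall>lam \<in> {lambda1 c - (INF r. y r) .. lambda2 c - (SUP r. y r)}.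
           bistability c y lam \<and>
           (\<exists>l m u. attractors_separated_by c y lam l m u)))"
proof (intro conjI allI ballI impI)
  have y_cont: "continuous_on UNIV y" using assms(2) by (rule uniformly_continuous_imp_continuous)
  have eq: "forced_equation c y" by (intro forced_equation.intro assms(1,3) y_cont)
  have bdd: "bdd_below (range y)" "bdd_above (range y)"
    using assms(1) by (auto simp: bounded_imp_bdd_below bounded_imp_bdd_above)
  have inf: "(INF r. y r) \<le> y t" for t by (rule cINF_lower[OF bdd(1)]) simp
  have sup: "y t \<le> (SUP r. y r)" for t by (rule cSUP_upper[OF _ bdd(2)]) simp
  note cp = critical_points(1,2)[OF assms(3)]
  have rp1_strict: "recurrently_positive (\<lambda>t. lam + y t - lambda1 c)"
    if "lambda1 c - (INF r. y r) < lam" for lam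
    by (rule recurrently_positive_const_bound[of "lam - (lambda1 c - (INF r. y r))"])
      (use that inf in \<open>auto simp: algebra_simps\<close>)
  have rp2_strict: "recurrently_positive (\<lambda>t. lambda2 c - (lam + y t))"
    if "lam < lambda2 c - (SUP r. y r)" for lam
    by (rule recurrently_positive_const_bound[of "lambda2 c - (SUP r. y r) - lam"])
      (use that sup in \<open>auto simp: algebra_simps\<close>)
  {
    fix lam assume "lambda1 c - (INF r. y r) < lam"
    interpret forced_equation c y lam by (rule eq)
    obtain u \<rho> where u: "sol u" "bounded (range u)" "0 < \<rho>" "\<And>t. x2 c + \<rho> \<le> u t"
      "hyperbolic_attractive c y lam u"
      "\<And>v. sol v \<Longrightarrow> bounded (range v) \<Longrightarrow> (\<And>t. x2 c \<le> v t) \<Longrightarrow> v = u"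
      "\<And>x s. sol x \<Longrightarrow> x2 c \<le> x s \<Longrightarrow> ((\<lambda>t. u t - x t) \<longlongrightarrow> 0) at_top"
      by (rule upper_attractor[OF rp1_strict[OF \<open>lambda1 c - (INF r. y r) < lam\<close>]]) blast
    have gt: "x2 c < u t" for t using u(3) u(4)[of t] by linarith
    have "0 \<le> u t" for t using gt[of t] cp by linarith
    then have "positive_bounded_above_x2 c y lam u"
      using u(1,2) gt by (simp add: positive_bounded_above_x2_def positive_def bounded_solution_def)
    moreover have "v = u" if "positive_bounded_above_x2 c y lam v" for v
      using that less_imp_le by (intro u(6)) (auto simp: positive_bounded_above_x2_def bounded_solution_def)
    moreover have "attracted_to I x u" if "maximal_solution c y lam I x" "s \<in> I" "x s \<in> {x2 c..}" for I x s
      using attracted_to_iff[OF that(1,2)] u(7)[OF maximal_solution_global(2)[OF that(1,2)]] that(3) by simp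
    ultimately show "\<exists>u. positive_bounded_above_x2 c y lam u \<and>
           (\<forall>v. positive_bounded_above_x2 c y lam v \<longrightarrow> v = u) \<and>
           hyperbolic_attractive c y lam u \<and>
           (\<forall>I x. maximal_solution c y lam I x \<and> (\<exists>s\<in>I. x s \<in> {x2 c..}) \<longrightarrow> attracted_to I x u)"
      using u(5) by blast
  }
  {
    fix lam assume lam: "lam \<in> {- (INF r. y r) ..< lambda2 c - (SUP r. y r)}"
    interpret forced_equation c y lam by (rule eq)
    have nonneg: "0 \<le> lam + y t" for t using lam inf[of t] by simp
    have rp2: "recurrently_positive (\<lambda>t. lambda2 c - (lam + y t))" using rp2_strict lam by simp
    obtain l \<rho> where l: "sol l" "0 < \<rho>" "\<And>t. 0 \<le> l t" "\<And>t. l t \<le> x1 c - \<rho>"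
      "hyperbolic_attractive c y lam l"
      "\<And>v. sol v \<Longrightarrow> (\<And>t. 0 \<le> v t) \<Longrightarrow> (\<And>t. v t \<le> x1 c) \<Longrightarrow> v = l"
      "\<And>x s. sol x \<Longrightarrow> 0 \<le> x s \<Longrightarrow> x s \<le> x1 c \<Longrightarrow> ((\<lambda>t. l t - x t) \<longlongrightarrow> 0) at_top"
      by (rule lower_attractor[OF nonneg rp2]) blast
    have "l t < x1 c" for t using l(2) l(4)[of t] by linarith
    then have "positive_bounded_below_x1 c y lam l"
      using l(3,5) by (simp add: positive_bounded_below_x1_def positive_def hyperbolic_attractive_def)
    moreover have "v = l" if "positive_bounded_below_x1 c y lam v" for v
      using that less_imp_le
      by (intro l(6)) (auto simp: positive_bounded_below_x1_def bounded_solution_def positive_def)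
    \<comment> \<open>The gain at the level 0, where the drift is the forcing itself.\<close>
    moreover have "strictly_positive l" if "lam > - (INF r. y r)"
    proof -
      have "recurrently_positive (\<lambda>t. 1 * 1 * (lam + y t + g c 0))"
        by (rule recurrently_positive_const_bound[of "lam + (INF r. y r)"])
          (use that inf in \<open>auto simp: g_zero\<close>)
      from level_gain[OF _ _ this] obtain W \<rho> where "0 < \<rho>"
        and gain: "\<forall>x s t. sol x \<longrightarrow> 0 \<le> 1 * (x s - 0) \<longrightarrow> W \<le> 1 * (t - s) \<longrightarrow> \<rho> \<le> 1 * (x t - 0)"
        by auto
      have "\<rho> \<le> l t" for t using gain[rule_format, OF l(1), of "t - W" t] l(3)[of "t - W"] by simp
      then show ?thesis using \<open>0 < \<rho>\<close> less_le_trans by (auto simp: strictly_positive_def)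
    qed
    moreover have "attracted_to I x l" if "maximal_solution c y lam I x" "s \<in> I" "x s \<in> {0..x1 c}" for I x s
      using attracted_to_iff[OF that(1,2)] l(7)[OF maximal_solution_global(2)[OF that(1,2)], of s] that(3) by simp
    ultimately show "\<exists>l. positive_bounded_below_x1 c y lam l \<and>
           (\<forall>v. positive_bounded_below_x1 c y lam v \<longrightarrow> v = l) \<and>
           hyperbolic_attractive c y lam l \<and>
           (lam > - (INF r. y r) \<longrightarrow> strictly_positive l) \<and>
           (\<forall>I x. maximal_solution c y lam I x \<and> (\<exists>s\<in>I. x s \<in> {0..x1 c}) \<longrightarrow> attracted_to I x l)"
      using l(5) by blast
  }
  {
    fix lam assume lam: "lam \<in> {lambda1 c - (INF r. y r) <..< lambda2 c - (SUP r. y r)}"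
    interpret forced_equation c y lam by (rule eq)
    have "recurrently_positive (\<lambda>t. lam + y t - lambda1 c)"
      "recurrently_positive (\<lambda>t. lambda2 c - (lam + y t))"
      using rp1_strict rp2_strict lam by auto
    from bistable[OF this] show "bistability c y lam" and "\<exists>l m u. positive_bounded_below_x1 c y lam l \<and>
        positive_bounded_above_x2 c y lam u \<and> attractors_separated_by c y lam l m u" .
  }
  {
    fix lam assume hull: "(SUP r. y r) - (INF r. y r) \<le> h1 c \<and>
        (\<lambda>t. INF r. y r) \<notin> hull_of y \<and> (\<lambda>t. SUP r. y r) \<notin> hull_of y"
      and lam: "lam \<in> {lambda1 c - (INF r. y r) .. lambda2 c - (SUP r. y r)}"
    interpret forced_equation c y lam by (rule eq)
    have rp1: "recurrently_positive (\<lambda>t. lam + y t - lambda1 c)"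
    proof (rule recurrently_positive_of_hull[OF assms(2)])
      show "0 \<le> lam + y t - lambda1 c" "\<bar>y t - (INF r. y r)\<bar> \<le> lam + y t - lambda1 c" for t
        using lam inf[of t] by auto
    qed (use hull in blast)
    have rp2: "recurrently_positive (\<lambda>t. lambda2 c - (lam + y t))"
    proof (rule recurrently_positive_of_hull[OF assms(2)])
      show "0 \<le> lambda2 c - (lam + y t)" "\<bar>y t - (SUP r. y r)\<bar> \<le> lambda2 c - (lam + y t)" for t
        using lam sup[of t] by auto
    qed (use hull in blast)
    show "bistability c y lam" and "\<exists>l m u. attractors_separated_by c y lam l m u"
      using bistable[OF rp1 rp2] by blast+
  }
qed

end
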